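(* Let $H$ be a complex Hilbert space, let $\mathcal{A}\subseteq B(H)$ be a commutative $C^{*}$-algebra of bounded linear operators on $H$, and let $\mathcal{A}^{+}$ be the set of strictly positive operators in $\mathcal{A}$. Let $I\subseteq (0,\infty)$ be an interval and let $f:I\to(0,\infty)$ be an operator geometrically convex function. Then for all $A,B\in\mathcal{A}^{+}$ with $\mathrm{Sp}(A)\subseteq I$ and $\mathrm{Sp}(B)\subseteq I$, $$\log f(\sqrt{AB})\leq \int_{0}^{1}\log f(A^{t}B^{1-t})\,dt\leq \log \sqrt{f(A)f(B)}.$$
   Context: $B(H)$ is the algebra of bounded linear operators on $H$; $\mathrm{Sp}(A)$ is the spectrum of $A$. An operator $A$ is positive ($A\geq 0$) if $\langle Ax,x\rangle\geq 0$ for all $x\in H$; strictly positive means positive and invertible; $A\le B$ means $B-A\geq 0$. Functions of self-adjoint operators ($f(A)$, $A^{t}$, $\sqrt{A}$, $\log A$) are defined by the continuous functional calculus. The integral is that of a norm-continuous operator-valued function. Definition. A continuous function $f:I\subseteq(0,\infty)\to(0,\infty)$, $I$ an interval, is operator geometrically convex if $$f(A^{\lambda}B^{1-\lambda})\leq f(A)^{\lambda}f(B)^{1-\lambda}$$ for all $\lambda\in[0,1]$ and all $A,B\in\mathcal{A}^{+}$ such that $\mathrm{Sp}(A),\mathrm{Sp}(B)\subseteq I$. (For $A,B\in\mathcal{A}^+$ with spectra in $I$, the operators $A^{\lambda}B^{1-\lambda}$ also have spectrum in $I$.) *)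

theory Defs
  imports "HOL-Analysis.Analysis"
begin

(* Complex Hilbert spaces, with the inner product linear in the first argument. The axiom
   cinner_self says both that cinner is positive definite and that it induces the norm;
   completeness is part of banach. *)
class complex_hilbert = banach +
  fixes scaleC :: "complex \<Rightarrow> 'a \<Rightarrow> 'a" (infixr "*\<^sub>C" 75)
    and cinner :: "'a \<Rightarrow> 'a \<Rightarrow> complex"
  assumes scaleC_add_right: "a *\<^sub>C (x + y) = a *\<^sub>C x + a *\<^sub>C y"
    and scaleC_add_left: "(a + b) *\<^sub>C x = a *\<^sub>C x + b *\<^sub>C x"
    and scaleC_scaleC: "a *\<^sub>C b *\<^sub>C x = (a * b) *\<^sub>C x"
    and scaleR_scaleC: "r *\<^sub>R x = complex_of_real r *\<^sub>C x"
    and cinner_commute: "cinner x y = cnj (cinner y x)"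
    and cinner_add_left: "cinner (x + y) z = cinner x z + cinner y z"
    and cinner_scaleC_left: "cinner (a *\<^sub>C x) y = a * cinner x y"
    and cinner_self: "cinner x x = complex_of_real ((norm x)\<^sup>2)"

lemma norm_scaleC: "norm (a *\<^sub>C x) = cmod a * norm (x :: 'a::complex_hilbert)"
proof -
  have "complex_of_real ((norm (a *\<^sub>C x))\<^sup>2) = a * cinner x (a *\<^sub>C x)"
    by (simp only: cinner_self[symmetric] cinner_scaleC_left)
  also have "cinner x (a *\<^sub>C x) = cnj a * cinner x x"
    by (subst (1 2) cinner_commute) (simp add: cinner_scaleC_left)
  also have "a * (cnj a * cinner x x) = complex_of_real ((cmod a * norm x)\<^sup>2)"
    by (simp add: cinner_self power_mult_distrib complex_norm_square[symmetric] mult.assoc[symmetric] flip: of_real_power)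
  finally have "(norm (a *\<^sub>C x))\<^sup>2 = (cmod a * norm x)\<^sup>2"
    by (simp only: of_real_eq_iff)
  then show ?thesis
    by (simp add: power2_eq_iff_nonneg)
qed

lemma bounded_linear_scaleC: "bounded_linear ((*\<^sub>C) a :: 'a::complex_hilbert \<Rightarrow> 'a)"
  by (rule bounded_linear_intro[where K = "cmod a"])
     (simp_all add: scaleC_add_right scaleR_scaleC scaleC_scaleC norm_scaleC mult.commute)

(* The elements of the library type 'a => 'a of bounded operators are only real-linear;
   B(H) consists of the complex-linear ones. *)
definition BH :: "('a::complex_hilbert \<Rightarrow>\<^sub>L 'a) set" where
  "BH = {T. \<forall>c x. blinfun_apply T (c *\<^sub>C x) = c *\<^sub>C blinfun_apply T x}"

lift_definition scaleC_op ::
  "complex \<Rightarrow> ('a::complex_hilbert \<Rightarrow>\<^sub>L 'a) \<Rightarrow> ('a \<Rightarrow>\<^sub>L 'a)"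
  is "\<lambda>c T x. c *\<^sub>C T x"
  by (rule bounded_linear_compose[OF bounded_linear_scaleC])

definition is_adjoint :: "('a::complex_hilbert \<Rightarrow>\<^sub>L 'a) \<Rightarrow> ('a \<Rightarrow>\<^sub>L 'a) \<Rightarrow> bool" where
  "is_adjoint T S \<longleftrightarrow> (\<forall>x y. cinner (blinfun_apply T x) y = cinner x (blinfun_apply S y))"

definition invertible_op :: "('a::complex_hilbert \<Rightarrow>\<^sub>L 'a) \<Rightarrow> bool" where
  "invertible_op T \<longleftrightarrow> (\<exists>S\<in>BH. T o\<^sub>L S = id_blinfun \<and> S o\<^sub>L T = id_blinfun)"

definition Sp :: "('a::complex_hilbert \<Rightarrow>\<^sub>L 'a) \<Rightarrow> complex set" where
  "Sp T = {z. \<not> invertible_op (T - scaleC_op z id_blinfun)}"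

definition positive_op :: "('a::complex_hilbert \<Rightarrow>\<^sub>L 'a) \<Rightarrow> bool" where
  "positive_op T \<longleftrightarrow> T \<in> BH \<and> (\<forall>x. cinner (blinfun_apply T x) x \<in> \<real>\<^sub>\<ge>\<^sub>0)"

definition le_op :: "('a::complex_hilbert \<Rightarrow>\<^sub>L 'a) \<Rightarrow> ('a \<Rightarrow>\<^sub>L 'a) \<Rightarrow> bool"
  (infix "\<le>\<^sub>o\<^sub>p" 50) where
  "S \<le>\<^sub>o\<^sub>p T \<longleftrightarrow> positive_op (T - S)"

(* Not assumed unital: as soon as the algebra contains an invertible positive operator, it
   contains the identity of H. *)
definition commutative_cstar_algebra :: "('a::complex_hilbert \<Rightarrow>\<^sub>L 'a) set \<Rightarrow> bool" where
  "commutative_cstar_algebra \<A> \<longleftrightarrow>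
     \<A> \<subseteq> BH \<and> 0 \<in> \<A> \<and>
     (\<forall>S\<in>\<A>. \<forall>T\<in>\<A>. S + T \<in> \<A>) \<and>
     (\<forall>c. \<forall>T\<in>\<A>. scaleC_op c T \<in> \<A>) \<and>
     (\<forall>S\<in>\<A>. \<forall>T\<in>\<A>. S o\<^sub>L T \<in> \<A>) \<and>
     (\<forall>T\<in>\<A>. \<exists>S\<in>\<A>. is_adjoint T S) \<and>
     closed \<A> \<and>
     (\<forall>S\<in>\<A>. \<forall>T\<in>\<A>. S o\<^sub>L T = T o\<^sub>L S)"

definition strictly_positive :: "('a::complex_hilbert \<Rightarrow>\<^sub>L 'a) set \<Rightarrow> ('a \<Rightarrow>\<^sub>L 'a) set" where
  "strictly_positive \<A> = {T\<in>\<A>. positive_op T \<and> invertible_op T}"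

(* The continuous functional calculus of T: the contractive unital *-homomorphism from C(Sp T)
   to B(H) that maps the inclusion of Sp T in the complex plane to T. Elements of C(Sp T) are
   represented by functions on the whole plane, and the last condition makes F g depend
   only on the restriction of g to Sp T. *)
definition continuous_functional_calculus ::
  "('a::complex_hilbert \<Rightarrow>\<^sub>L 'a) \<Rightarrow> ((complex \<Rightarrow> complex) \<Rightarrow> ('a \<Rightarrow>\<^sub>L 'a)) \<Rightarrow> bool" where
  "continuous_functional_calculus T F \<longleftrightarrow>
     (\<forall>g. continuous_on (Sp T) g \<longrightarrow> F g \<in> BH) \<and>
     F (\<lambda>z. 1) = id_blinfun \<and>
     F (\<lambda>z. z) = T \<and>
     (\<forall>g h. continuous_on (Sp T) g \<longrightarrow> continuous_on (Sp T) h \<longrightarrow>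
        F (\<lambda>z. g z + h z) = F g + F h \<and>
        F (\<lambda>z. g z * h z) = F g o\<^sub>L F h) \<and>
     (\<forall>c g. continuous_on (Sp T) g \<longrightarrow> F (\<lambda>z. c * g z) = scaleC_op c (F g)) \<and>
     (\<forall>g. continuous_on (Sp T) g \<longrightarrow> is_adjoint (F g) (F (\<lambda>z. cnj (g z)))) \<and>
     (\<forall>g r. continuous_on (Sp T) g \<longrightarrow> r \<ge> 0 \<longrightarrow> (\<forall>z\<in>Sp T. cmod (g z) \<le> r) \<longrightarrow> norm (F g) \<le> r)"

(* f(T) for a self-adjoint operator T and a real function f that is continuous on the (real)
   spectrum of T. *)
definition fun_op :: "(real \<Rightarrow> real) \<Rightarrow> ('a::complex_hilbert \<Rightarrow>\<^sub>L 'a) \<Rightarrow> ('a \<Rightarrow>\<^sub>L 'a)" where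
  "fun_op f T = (THE S. \<exists>F. continuous_functional_calculus T F \<and>
                            S = F (\<lambda>z. complex_of_real (f (Re z))))"

abbreviation powr_op :: "('a::complex_hilbert \<Rightarrow>\<^sub>L 'a) \<Rightarrow> real \<Rightarrow> ('a \<Rightarrow>\<^sub>L 'a)"
  (infixr "powr\<^sub>o\<^sub>p" 80) where
  "T powr\<^sub>o\<^sub>p t \<equiv> fun_op (\<lambda>x. x powr t) T"

definition operator_geometrically_convex ::
  "('a::complex_hilbert \<Rightarrow>\<^sub>L 'a) set \<Rightarrow> real set \<Rightarrow> (real \<Rightarrow> real) \<Rightarrow> bool" where
  "operator_geometrically_convex \<A> I f \<longleftrightarrow>
     is_interval I \<and> I \<subseteq> {0<..} \<and> continuous_on I f \<and> f \<in> I \<rightarrow> {0<..} \<and>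
     (\<forall>l\<in>{0..1}. \<forall>A\<in>strictly_positive \<A>. \<forall>B\<in>strictly_positive \<A>.
        Sp A \<subseteq> complex_of_real ` I \<longrightarrow> Sp B \<subseteq> complex_of_real ` I \<longrightarrow>
        fun_op f (A powr\<^sub>o\<^sub>p l o\<^sub>L B powr\<^sub>o\<^sub>p (1 - l))
          \<le>\<^sub>o\<^sub>p fun_op f A powr\<^sub>o\<^sub>p l o\<^sub>L fun_op f B powr\<^sub>o\<^sub>p (1 - l))"

end

theory Submission
  imports Defs "HOL-Computational_Algebra.Fundamental_Theorem_Algebra"
begin

text \<open>
  A self-adjoint operator \<open>T\<close> satisfies \<open>\<parallel>p(T)\<parallel> \<le> sup |p|\<close> over its spectrum, because one of \<open>\<plusminus>\<parallel>S\<parallel>\<close> lies in the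
  spectrum of a self-adjoint \<open>S\<close> and polynomials factor over the complex numbers; with the Weierstrass theorem
  this yields the continuous functional calculus. Put \<open>K = ln A\<close>, \<open>L = ln B\<close> and
  \<open>F(t) = ln f(exp(t K + (1 - t) L))\<close>. As \<open>exp\<close> turns sums of commuting operators into products and \<open>ln\<close> is
  monotone on commuting operators, operator geometric convexity of \<open>f\<close> says that \<open>F\<close> is convex, and the claim
  is the Hermite-Hadamard inequality for \<open>F\<close>.
\<close>

section \<open>Operators on a complex Hilbert space\<close>

text \<open>\<open>fun_op\<close> is a definite description, so the calculus must be shown to exist
  and to be unique before anything can be computed with it; uniqueness comes from contractivity
  together with the values on polynomials. The main obstacle is that this calculus handles one
  operator at a time. For commuting \<open>K\<close> and \<open>L\<close> there is no function of
  two variables from which exp (K + L) = exp K exp L could be read off. The law is recovered from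
  its infinitesimal form: the dyadic roots of the product are known explicitly, and a logarithm is
  determined by how these roots approach the identity. Two further points shape the final argument.
  The interval \<open>I\<close> may be open or unbounded, so the spectra of \<open>A\<close> and
  \<open>B\<close> are enclosed in a compact interval inside \<open>I\<close>; operator inequalities
  show that the logarithms along the whole curve keep their spectra in the matching interval, which
  gives norm continuity of F. And every operator that occurs is kept inside the algebra, whose
  commutativity then supplies the commutation that the laws for exp and ln demand; for this the
  identity must first be found in the algebra.\<close>

lemma cinner_add_right: "cinner x (y + z) = cinner x y + cinner x (z :: 'a::complex_hilbert)"
  by (metis cinner_commute cinner_add_left complex_cnj_add)

lemma cinner_scaleC_right: "cinner x (a *\<^sub>C y) = cnj a * cinner x (y :: 'a::complex_hilbert)"
  by (metis cinner_commute cinner_scaleC_left complex_cnj_mult)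

lemma norm_add_power2:
  "(norm (x + y :: 'a::complex_hilbert))\<^sup>2 = (norm x)\<^sup>2 + 2 * Re (cinner x y) + (norm y)\<^sup>2"
proof -
  have "(norm (x + y))\<^sup>2 = Re (cinner (x + y) (x + y))"
    by (simp add: cinner_self del: of_real_power)
  also have "\<dots> = Re (cinner x x) + Re (cinner x y) + Re (cinner y x) + Re (cinner y y)"
    by (simp add: cinner_add_left cinner_add_right)
  also have "Re (cinner y x) = Re (cinner x y)"
    by (subst cinner_commute) simp
  finally show ?thesis
    by (simp add: cinner_self del: of_real_power)
qed

text \<open>Squaring the triangle inequality and expanding both sides leaves exactly the cross
  terms.\<close>

lemma Re_cinner_le: "Re (cinner x y) \<le> norm x * norm (y :: 'a::complex_hilbert)"
proof -
  have "(norm (x + y))\<^sup>2 \<le> (norm x + norm y)\<^sup>2"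
    by (intro power_mono norm_triangle_ineq) auto
  then show ?thesis
    by (simp add: norm_add_power2 power2_sum)
qed

lemma norm_cinner_le: "cmod (cinner x y) \<le> norm x * norm (y :: 'a::complex_hilbert)"
proof (cases "cinner x y = 0")
  case False
  \<comment> \<open>The phase that turns the inner product into its modulus. The bound for real
    parts then applies to \<open>u *\<^sub>C x\<close>, which has the norm of
    \<open>x\<close>.\<close>
  define u where "u = cnj (cinner x y) / cmod (cinner x y)"
  have "u * cinner x y = cmod (cinner x y)"
    using False by (simp add: u_def mult.commute flip: complex_norm_square) (simp add: power2_eq_square)
  then have "cmod (cinner x y) = Re (cinner (u *\<^sub>C x) y)"
    by (simp add: cinner_scaleC_left)
  also have "\<dots> \<le> norm (u *\<^sub>C x) * norm y"
    by (rule Re_cinner_le)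
  also have "cmod u = 1"
    using False by (simp add: u_def norm_divide)
  then have "norm (u *\<^sub>C x) = norm x"
    by (simp add: norm_scaleC)
  finally show ?thesis .
qed simp

text \<open>Sesquilinearity over the complex numbers is bilinearity over the reals; this view
  supplies the sign, difference and limit rules for the inner product.\<close>

interpretation cinner: bounded_bilinear "cinner :: 'a::complex_hilbert \<Rightarrow> 'a \<Rightarrow> complex"
proof
  show "\<exists>K. \<forall>a b :: 'a. norm (cinner a b) \<le> norm a * norm b * K"
    by (rule exI[of _ 1]) (simp add: norm_cinner_le)
qed (simp_all add: cinner_add_left cinner_add_right scaleR_scaleC cinner_scaleC_left
      cinner_scaleC_right scaleR_conv_of_real)

interpretation blinfun_compose: bounded_bilinear "(o\<^sub>L)"
  by (rule bounded_bilinear_blinfun_compose)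

lemma norm_diff_power2:
  "(norm (x - y :: 'a::complex_hilbert))\<^sup>2 = (norm x)\<^sup>2 - 2 * Re (cinner x y) + (norm y)\<^sup>2"
  using norm_add_power2[of x "- y"] by (simp add: cinner.minus_right)

lemma scaleC_diff_right: "a *\<^sub>C (x - y) = a *\<^sub>C x - a *\<^sub>C (y :: 'a::complex_hilbert)"
  by (rule bounded_linear.linear[OF bounded_linear_scaleC, THEN linear_diff])

lemma scaleC_zero_right [simp]: "a *\<^sub>C 0 = (0 :: 'a::complex_hilbert)"
  by (rule bounded_linear.linear[OF bounded_linear_scaleC, THEN linear_0])

lemma scaleC_one [simp]: "1 *\<^sub>C x = (x :: 'a::complex_hilbert)"
  using scaleR_scaleC[of 1 x] by simp

lemma scaleC_zero_left [simp]: "0 *\<^sub>C x = (0 :: 'a::complex_hilbert)"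
  using scaleR_scaleC[of 0 x] by simp

lemma scaleC_minus_left [simp]: "(- a) *\<^sub>C x = - (a *\<^sub>C (x :: 'a::complex_hilbert))"
  using scaleC_add_left[of "- a" a x] by (simp add: eq_neg_iff_add_eq_0)

lemma scaleC_diff_left: "(a - b) *\<^sub>C x = a *\<^sub>C x - b *\<^sub>C (x :: 'a::complex_hilbert)"
  using scaleC_add_left[of a "- b" x] by simp

lemma apply_scaleC_op [simp]: "blinfun_apply (scaleC_op c T) x = c *\<^sub>C blinfun_apply T x"
  by (simp add: scaleC_op.rep_eq)

lemmas op_apply = blinfun.add_left blinfun.diff_left blinfun.minus_left blinfun.scaleR_left
  blinfun.zero_left blinfun.add_right blinfun.diff_right blinfun.minus_right blinfun.scaleR_right
  blinfun.zero_right

lemma scaleC_op_of_real: "scaleC_op (complex_of_real r) T = r *\<^sub>R T"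
  by (rule blinfun_eqI) (simp add: op_apply scaleR_scaleC)

lemma norm_scaleC_op: "norm (scaleC_op c T) \<le> cmod c * norm T"
proof (rule norm_blinfun_bound)
  fix x show "norm (blinfun_apply (scaleC_op c T) x) \<le> cmod c * norm T * norm x"
    using norm_blinfun[of T x]
    by (simp add: norm_scaleC mult_left_mono mult.assoc)
qed simp

section \<open>Complex-linear operators and invertibility\<close>

lemma BH_apply: "T \<in> BH \<Longrightarrow> blinfun_apply T (c *\<^sub>C x) = c *\<^sub>C blinfun_apply T x"
  by (simp add: BH_def)

lemma BH_intros [intro!, simp]:
  "0 \<in> BH" "id_blinfun \<in> BH"
  "S \<in> BH \<Longrightarrow> T \<in> BH \<Longrightarrow> S + T \<in> BH"
  "S \<in> BH \<Longrightarrow> T \<in> BH \<Longrightarrow> S - T \<in> BH"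
  "S \<in> BH \<Longrightarrow> T \<in> BH \<Longrightarrow> S o\<^sub>L T \<in> BH"
  "T \<in> BH \<Longrightarrow> scaleC_op c T \<in> BH"
  "T \<in> BH \<Longrightarrow> r *\<^sub>R T \<in> BH"
  by (auto simp: BH_def op_apply scaleC_add_right scaleC_diff_right scaleC_scaleC mult.commute scaleR_scaleC)

text \<open>The set-theoretic inverse of a surjective operator that is bounded below by
  \<open>c\<close> is bounded by 1/c, so no open mapping argument enters. It inherits complex
  linearity from \<open>T\<close>.\<close>

lemma invertible_op_iff:
  assumes "T \<in> BH"
  shows "invertible_op T \<longleftrightarrow>
    surj (blinfun_apply T) \<and> (\<exists>c>0. \<forall>x. c * norm x \<le> norm (blinfun_apply T x))"
proof (intro iffI conjI)
  assume "invertible_op T"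
  then obtain S where TS: "T o\<^sub>L S = id_blinfun" and ST: "S o\<^sub>L T = id_blinfun"
    by (auto simp: invertible_op_def)
  have TS': "blinfun_apply T (blinfun_apply S x) = x" for x
    using arg_cong[OF TS, of "\<lambda>R. blinfun_apply R x"] by simp
  have ST': "blinfun_apply S (blinfun_apply T x) = x" for x
    using arg_cong[OF ST, of "\<lambda>R. blinfun_apply R x"] by simp
  show "surj (blinfun_apply T)"
    by (metis TS' surjI)
  show "\<exists>c>0. \<forall>x. c * norm x \<le> norm (blinfun_apply T x)"
  \<comment> \<open>The summand 1 keeps the denominator positive on the zero space, where
    \<open>norm S = 0\<close>.\<close>
  proof (intro exI[of _ "1 / (norm S + 1)"] conjI allI)
    show "0 < 1 / (norm S + 1)"
      by (smt (verit) norm_ge_zero zero_less_divide_1_iff)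
    fix x
    have "norm x \<le> norm S * norm (blinfun_apply T x)"
      using norm_blinfun[of S "blinfun_apply T x"] by (simp add: ST')
    also have "\<dots> \<le> (norm S + 1) * norm (blinfun_apply T x)"
      by (intro mult_right_mono) auto
    finally show "1 / (norm S + 1) * norm x \<le> norm (blinfun_apply T x)"
      by (simp add: divide_le_eq mult.commute pos_divide_le_eq add_nonneg_pos)
  qed
next
  assume "surj (blinfun_apply T) \<and> (\<exists>c>0. \<forall>x. c * norm x \<le> norm (blinfun_apply T x))"
  then obtain c where surj: "surj (blinfun_apply T)" and "c > 0"
    and c: "\<And>x. c * norm x \<le> norm (blinfun_apply T x)"
    by auto
  have "inj (blinfun_apply T)"
  proof (rule injI)
    fix x y assume "blinfun_apply T x = blinfun_apply T y"
    then show "x = y"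
      using c[of "x - y"] \<open>c > 0\<close> by (simp add: op_apply mult_le_0_iff)
  qed
  define g where "g = inv (blinfun_apply T)"
  have Tg: "blinfun_apply T (g x) = x" for x
    unfolding g_def by (rule surj_f_inv_f[OF surj])
  have gT: "g (blinfun_apply T x) = x" for x
    unfolding g_def by (rule inv_f_f[OF \<open>inj (blinfun_apply T)\<close>])
  have "bounded_linear g"
  proof (rule bounded_linear_intro[where K = "1 / c"])
    show "g (x + y) = g x + g y" for x y
      by (metis Tg gT blinfun.add_right)
    show "g (r *\<^sub>R x) = r *\<^sub>R g x" for r x
      by (metis Tg gT blinfun.scaleR_right)
    show "norm (g x) \<le> norm x * (1 / c)" for x
      using c[of "g x"] \<open>c > 0\<close> by (simp add: Tg field_simps)
  qed
  then have ap: "blinfun_apply (Blinfun g) = g"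
    by (rule bounded_linear_Blinfun_apply)
  have "g (a *\<^sub>C x) = a *\<^sub>C g x" for a x
    by (metis Tg gT BH_apply[OF assms])
  then have "Blinfun g \<in> BH"
    by (simp add: BH_def ap)
  moreover have "T o\<^sub>L Blinfun g = id_blinfun" "Blinfun g o\<^sub>L T = id_blinfun"
    by (auto intro!: blinfun_eqI simp: ap Tg gT)
  ultimately show "invertible_op T"
    by (auto simp: invertible_op_def)
qed

lemma invertible_op_compose:
  assumes "invertible_op S" "invertible_op T"
  shows "invertible_op (S o\<^sub>L T)"
proof -
  obtain S' T' where "S' \<in> BH" "T' \<in> BH"
    and S: "S o\<^sub>L S' = id_blinfun" "S' o\<^sub>L S = id_blinfun"
    and T: "T o\<^sub>L T' = id_blinfun" "T' o\<^sub>L T = id_blinfun"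
    using assms by (auto simp: invertible_op_def)
  have "blinfun_apply S (blinfun_apply S' x) = x" "blinfun_apply S' (blinfun_apply S x) = x"
       "blinfun_apply T (blinfun_apply T' x) = x" "blinfun_apply T' (blinfun_apply T x) = x" for x
    using S T by (metis blinfun_apply_blinfun_compose id_blinfun.rep_eq id_apply)+
  then have "(S o\<^sub>L T) o\<^sub>L (T' o\<^sub>L S') = id_blinfun" "(T' o\<^sub>L S') o\<^sub>L (S o\<^sub>L T) = id_blinfun"
    by (auto intro!: blinfun_eqI)
  then show ?thesis
    using \<open>S' \<in> BH\<close> \<open>T' \<in> BH\<close> by (auto simp: invertible_op_def)
qed

lemma is_adjoint_apply:
  "is_adjoint T S \<Longrightarrow> cinner (blinfun_apply T x) y = cinner x (blinfun_apply S y)"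
  by (simp add: is_adjoint_def)

lemma is_adjoint_sym: "is_adjoint T S \<Longrightarrow> is_adjoint S T"
  by (metis is_adjoint_def cinner_commute)

text \<open>For \<open>a\<close> small, the map that sends \<open>x\<close> to \<open>x - a (T* T x - y)\<close> is a contraction, so \<open>T* T\<close> is onto.\<close>
lemma normal_bounded_below_imp_invertible:
  fixes T :: "'a::complex_hilbert \<Rightarrow>\<^sub>L 'a"
  assumes "T \<in> BH" and adj: "is_adjoint T S" and comm: "T o\<^sub>L S = S o\<^sub>L T"
    and "c > 0" and c: "\<And>x. c * norm x \<le> norm (blinfun_apply T x)"
  shows "invertible_op T"
proof -
  define Q where "Q = S o\<^sub>L T"
  \<comment> \<open>Expanding the norm of x - a Q x gives the factor 1 - 2 a c^2 + a^2 (norm Q)^2.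
    With a = c^2 / N and N at least (norm Q)^2, the last term is at most a c^2; the summand c^2
    makes N positive.\<close>
  define N where "N = c\<^sup>2 + (norm Q)\<^sup>2"
  have "N > 0"
    using \<open>c > 0\<close> by (simp add: N_def add_pos_nonneg)
  define a where "a = c\<^sup>2 / N"
  have "a > 0"
    using \<open>c > 0\<close> \<open>N > 0\<close> by (simp add: a_def)
  define k where "k = 1 - a * c\<^sup>2"
  have bound: "(norm (x - a *\<^sub>R blinfun_apply Q x))\<^sup>2 \<le> k * (norm x)\<^sup>2" for x
  proof -
    have "Re (cinner x (blinfun_apply Q x)) = (norm (blinfun_apply T x))\<^sup>2"
      using arg_cong[OF is_adjoint_apply[OF adj, of x "blinfun_apply T x"], of Re]
      by (simp add: Q_def cinner_self del: of_real_power)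
    moreover have "(c * norm x)\<^sup>2 \<le> (norm (blinfun_apply T x))\<^sup>2"
      using c[of x] \<open>c > 0\<close> by (intro power_mono) auto
    moreover have "(norm (blinfun_apply Q x))\<^sup>2 \<le> (norm Q * norm x)\<^sup>2"
      using norm_blinfun[of Q x] by (intro power_mono) auto
    ultimately have "(norm (x - a *\<^sub>R blinfun_apply Q x))\<^sup>2
        \<le> (norm x)\<^sup>2 - 2 * a * (c * norm x)\<^sup>2 + a\<^sup>2 * (norm Q * norm x)\<^sup>2"
      using \<open>a > 0\<close> unfolding norm_diff_power2
      by (intro add_mono diff_mono) (auto simp: cinner.scaleR_right power_mult_distrib intro: mult_left_mono)
    also have "\<dots> = (1 - 2 * a * c\<^sup>2 + a * (a * (norm Q)\<^sup>2)) * (norm x)\<^sup>2"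
      by (simp add: power2_eq_square algebra_simps)
    also have "\<dots> \<le> k * (norm x)\<^sup>2"
    proof (rule mult_right_mono)
      have "a * (norm Q)\<^sup>2 \<le> a * N"
        using \<open>a > 0\<close> by (simp add: N_def)
      also have "\<dots> = c\<^sup>2"
        using \<open>N > 0\<close> by (simp add: a_def)
      finally have "a * (a * (norm Q)\<^sup>2) \<le> a * c\<^sup>2"
        using \<open>a > 0\<close> by (simp add: mult_left_mono)
      then show "1 - 2 * a * c\<^sup>2 + a * (a * (norm Q)\<^sup>2) \<le> k"
        by (simp add: k_def)
    qed simp
    finally show ?thesis .
  qed
  have "k < 1"
    using \<open>a > 0\<close> \<open>c > 0\<close> by (simp add: k_def)
  have ex: "\<exists>x. blinfun_apply Q x = y" for y
  \<comment> \<open>The contraction constant is \<open>sqrt k\<close>. A negative \<open>k\<close>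
    makes the bound force every vector to be 0, so the equation is trivially solvable.\<close>
  proof (cases "k \<ge> 0")
    case True
    have "\<exists>!x\<in>UNIV. x - a *\<^sub>R (blinfun_apply Q x - y) = x"
    proof (rule Banach_fix[where c = "sqrt k"])
      show "sqrt k < 1" using \<open>k < 1\<close> by simp
      fix u v :: 'a
      have "dist (u - a *\<^sub>R (blinfun_apply Q u - y)) (v - a *\<^sub>R (blinfun_apply Q v - y))
          = norm ((u - v) - a *\<^sub>R blinfun_apply Q (u - v))"
        by (simp add: dist_norm op_apply algebra_simps)
      also have "\<dots> \<le> sqrt k * norm (u - v)"
        using bound[of "u - v"] True
        by - (rule power2_le_imp_le, auto simp: power_mult_distrib)
      finally show "dist (u - a *\<^sub>R (blinfun_apply Q u - y)) (v - a *\<^sub>R (blinfun_apply Q v - y))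
          \<le> sqrt k * dist u v"
        by (simp add: dist_norm)
    qed (use True in \<open>auto simp: complete_UNIV\<close>)
    then obtain x where "x - a *\<^sub>R (blinfun_apply Q x - y) = x"
      by blast
    then show ?thesis
      using \<open>a > 0\<close> by auto
  next
    case False
    have "norm x = 0" for x :: 'a
      using bound[of x] False
      by (smt (verit) mult_neg_pos zero_le_power2 zero_less_power2)
    then have "y = 0" by simp
    then show ?thesis
      by (metis blinfun.zero_right)
  qed
  have "surj (blinfun_apply T)"
  proof (rule surjI)
    fix y
    \<comment> \<open>Normality enters here: a solution of S (T x) = y also satisfies T (S x) =
      y.\<close>
    have "blinfun_apply T (blinfun_apply S x) = blinfun_apply Q x" for x
      unfolding Q_def comm[symmetric] by simp
    then show "blinfun_apply T (blinfun_apply S (SOME x. blinfun_apply Q x = y)) = y"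
      using someI_ex[OF ex[of y]] by simp
  qed
  then show ?thesis
    using \<open>c > 0\<close> c \<open>T \<in> BH\<close> by (auto simp: invertible_op_iff)
qed

section \<open>Self-adjoint operators and their spectra\<close>

definition selfadjoint :: "('a::complex_hilbert \<Rightarrow>\<^sub>L 'a) \<Rightarrow> bool" where
  "selfadjoint T \<longleftrightarrow> T \<in> BH \<and> is_adjoint T T"

lemma selfadjoint_BH [simp]: "selfadjoint T \<Longrightarrow> T \<in> BH"
  by (simp add: selfadjoint_def)

lemma selfadjoint_cinner:
  "selfadjoint T \<Longrightarrow> cinner (blinfun_apply T x) y = cinner x (blinfun_apply T y)"
  by (simp add: selfadjoint_def is_adjoint_apply)

lemma selfadjoint_Im_cinner [simp]: "selfadjoint T \<Longrightarrow> Im (cinner (blinfun_apply T x) x) = 0"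
  by (metis selfadjoint_cinner cinner_commute complex_cnj_cancel_iff Reals_cnj_iff complex_is_Real_iff)

lemma is_adjoint_scaleC_op: "is_adjoint T S \<Longrightarrow> is_adjoint (scaleC_op c T) (scaleC_op (cnj c) S)"
  by (simp add: is_adjoint_def cinner_scaleC_left cinner_scaleC_right)

lemma is_adjoint_id [simp]: "is_adjoint id_blinfun id_blinfun"
  by (simp add: is_adjoint_def)

lemma is_adjoint_add: "is_adjoint T S \<Longrightarrow> is_adjoint T' S' \<Longrightarrow> is_adjoint (T + T') (S + S')"
  by (simp add: is_adjoint_def op_apply cinner.add_left cinner.add_right)

lemma is_adjoint_diff: "is_adjoint T S \<Longrightarrow> is_adjoint T' S' \<Longrightarrow> is_adjoint (T - T') (S - S')"
  by (simp add: is_adjoint_def op_apply cinner.diff_left cinner.diff_right)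

lemma is_adjoint_compose: "is_adjoint T S \<Longrightarrow> is_adjoint T' S' \<Longrightarrow> is_adjoint (T o\<^sub>L T') (S' o\<^sub>L S)"
  by (simp add: is_adjoint_def)

lemma selfadjoint_intros [intro!, simp]:
  "selfadjoint id_blinfun" "selfadjoint 0"
  "selfadjoint S \<Longrightarrow> selfadjoint T \<Longrightarrow> selfadjoint (S + T)"
  "selfadjoint S \<Longrightarrow> selfadjoint T \<Longrightarrow> selfadjoint (S - T)"
  "selfadjoint T \<Longrightarrow> selfadjoint (r *\<^sub>R T)"
  using is_adjoint_scaleC_op[of T T "complex_of_real r"]
  by (auto simp: selfadjoint_def is_adjoint_add is_adjoint_diff scaleC_op_of_real)
     (simp_all add: is_adjoint_def op_apply cinner.zero_left cinner.zero_right)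

lemma selfadjoint_compose:
  "selfadjoint S \<Longrightarrow> selfadjoint T \<Longrightarrow> S o\<^sub>L T = T o\<^sub>L S \<Longrightarrow> selfadjoint (S o\<^sub>L T)"
  using is_adjoint_compose[of S S T T] by (simp add: selfadjoint_def)

text \<open>Polarization: reality of the quadratic form at x + y matches the imaginary parts of the
  two mixed terms, and reality at x + i y matches their real parts.\<close>

lemma positive_imp_selfadjoint:
  assumes "positive_op T"
  shows "selfadjoint T"
proof -
  have T: "T \<in> BH" and real: "Im (cinner (blinfun_apply T x) x) = 0" for x
    using assms by (auto simp: positive_op_def complex_nonneg_Reals_iff)
  have "cinner (blinfun_apply T x) y = cinner x (blinfun_apply T y)" for x y
  proof -
    have "Im (cinner (blinfun_apply T x) y) + Im (cinner (blinfun_apply T y) x) = 0"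
      using real[of "x + y"] real[of x] real[of y]
      by (simp add: op_apply cinner_add_left cinner_add_right)
    moreover have "Re (cinner (blinfun_apply T y) x) = Re (cinner (blinfun_apply T x) y)"
      using real[of "x + \<i> *\<^sub>C y"] real[of x] real[of y]
      by (simp add: op_apply cinner_add_left cinner_add_right cinner_scaleC_left
          cinner_scaleC_right BH_apply[OF T])
    ultimately have "cinner (blinfun_apply T x) y = cnj (cinner (blinfun_apply T y) x)"
      by (simp add: complex_eq_iff)
    then show ?thesis
      by (metis cinner_commute)
  qed
  then show ?thesis
    using T by (simp add: selfadjoint_def is_adjoint_def)
qed

lemma positive_op_iff:
  "positive_op T \<longleftrightarrow> selfadjoint T \<and> (\<forall>x. 0 \<le> Re (cinner (blinfun_apply T x) x))"
proof
  assume "positive_op T"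
  then show "selfadjoint T \<and> (\<forall>x. 0 \<le> Re (cinner (blinfun_apply T x) x))"
    by (simp add: positive_imp_selfadjoint) (simp add: positive_op_def complex_nonneg_Reals_iff)
next
  assume "selfadjoint T \<and> (\<forall>x. 0 \<le> Re (cinner (blinfun_apply T x) x))"
  then show "positive_op T"
    by (simp add: positive_op_def complex_nonneg_Reals_iff)
qed

text \<open>T - z commutes with its adjoint, so being bounded below already makes it invertible. The
  spectrum thus consists of approximate eigenvalues, and statements about it become norm
  estimates.\<close>

lemma Sp_iff:
  assumes "selfadjoint T"
  shows "z \<in> Sp T \<longleftrightarrow>
    \<not> (\<exists>c>0. \<forall>x. c * norm x \<le> norm (blinfun_apply T x - z *\<^sub>C x))"
proof -
  have [simp]: "T - scaleC_op z id_blinfun \<in> BH" for z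
    using assms by simp
  have "is_adjoint (T - scaleC_op z id_blinfun) (T - scaleC_op (cnj z) id_blinfun)"
    using assms by (intro is_adjoint_diff is_adjoint_scaleC_op) (auto simp: selfadjoint_def)
  moreover have "(T - scaleC_op z id_blinfun) o\<^sub>L (T - scaleC_op (cnj z) id_blinfun)
      = (T - scaleC_op (cnj z) id_blinfun) o\<^sub>L (T - scaleC_op z id_blinfun)"
    using assms
    by (intro blinfun_eqI)
       (simp add: op_apply BH_apply scaleC_diff_right scaleC_scaleC algebra_simps)
  ultimately have "invertible_op (T - scaleC_op z id_blinfun) \<longleftrightarrow>
    (\<exists>c>0. \<forall>x. c * norm x \<le> norm (blinfun_apply (T - scaleC_op z id_blinfun) x))"
    using normal_bounded_below_imp_invertible[of "T - scaleC_op z id_blinfun"]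
      invertible_op_iff[of "T - scaleC_op z id_blinfun"] by auto
  then show ?thesis
    by (simp add: Sp_def op_apply)
qed

lemma Sp_Im:
  assumes "selfadjoint T" "z \<in> Sp T"
  shows "Im z = 0"
proof (rule ccontr)
  assume "Im z \<noteq> 0"
  have "\<bar>Im z\<bar> * norm x \<le> norm (blinfun_apply T x - z *\<^sub>C x)" for x
  proof -
    \<comment> \<open>Removing the real part of \<open>z\<close> leaves a self-adjoint operator,
      whose form is real. The cross term with the purely imaginary multiple of \<open>x\<close>
      vanishes, and Pythagoras gives the lower bound.\<close>
    define u where "u = blinfun_apply (T - Re z *\<^sub>R id_blinfun) x"
    have "Im (cinner u x) = 0"
      using assms(1) unfolding u_def by (intro selfadjoint_Im_cinner) auto
    then have "Re (cinner u ((\<i> * Im z) *\<^sub>C x)) = 0"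
      by (simp add: cinner_scaleC_right)
    moreover have "blinfun_apply T x - z *\<^sub>C x = u - (\<i> * Im z) *\<^sub>C x"
      by (subst complex_eq[of z]) (simp add: u_def op_apply scaleR_scaleC scaleC_add_left algebra_simps)
    ultimately have "(norm (blinfun_apply T x - z *\<^sub>C x))\<^sup>2 = (norm u)\<^sup>2 + (\<bar>Im z\<bar> * norm x)\<^sup>2"
      by (simp add: norm_diff_power2 norm_scaleC norm_mult)
    then show ?thesis
      by - (rule power2_le_imp_le, auto)
  qed
  then show False
    using assms \<open>Im z \<noteq> 0\<close> Sp_iff[of T z] by (metis zero_less_abs_iff)
qed

lemma Sp_norm_le:
  assumes "selfadjoint T" "z \<in> Sp T"
  shows "cmod z \<le> norm T"
proof (rule ccontr)
  assume "\<not> cmod z \<le> norm T"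
  have "(cmod z - norm T) * norm x \<le> norm (blinfun_apply T x - z *\<^sub>C x)" for x
  proof -
    have "norm (z *\<^sub>C x) - norm (blinfun_apply T x) \<le> norm (blinfun_apply T x - z *\<^sub>C x)"
      by (metis norm_minus_commute norm_triangle_ineq2)
    then show ?thesis
      using norm_blinfun[of T x] by (simp add: norm_scaleC algebra_simps)
  qed
  then show False
    using assms \<open>\<not> cmod z \<le> norm T\<close> Sp_iff[of T z] by (metis diff_gt_0_iff_gt not_le)
qed

text \<open>A lower bound \<open>c\<close> at \<open>z\<close> leaves the lower bound c/2 at every
  point closer to \<open>z\<close> than c/2, so the complement is open; boundedness comes from the
  operator norm.\<close>

lemma compact_Sp:
  assumes "selfadjoint T"
  shows "compact (Sp T)"
proof -
  have "bounded (Sp T)"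
    using Sp_norm_le[OF assms] by (auto simp: bounded_iff)
  moreover have "open (- Sp T)"
    unfolding open_dist
  proof (intro ballI)
    fix z assume "z \<in> - Sp T"
    then obtain c where "c > 0" and c: "\<And>x. c * norm x \<le> norm (blinfun_apply T x - z *\<^sub>C x)"
      by (auto simp: Sp_iff[OF assms])
    show "\<exists>e>0. \<forall>w. dist w z < e \<longrightarrow> w \<in> - Sp T"
    proof (intro exI[of _ "c / 2"] conjI allI impI)
      fix w assume "dist w z < c / 2"
      have "c / 2 * norm x \<le> norm (blinfun_apply T x - w *\<^sub>C x)" for x
      proof -
        have "norm (blinfun_apply T x - z *\<^sub>C x)
            \<le> norm (blinfun_apply T x - w *\<^sub>C x) + cmod (w - z) * norm x"
          using norm_triangle_ineq[of "blinfun_apply T x - w *\<^sub>C x" "(w - z) *\<^sub>C x"]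
            norm_scaleC[of "w - z" x] by (simp add: scaleC_diff_left)
        moreover have "cmod (w - z) * norm x \<le> c / 2 * norm x"
          using \<open>dist w z < c / 2\<close> by (intro mult_right_mono) (auto simp: dist_norm)
        ultimately show ?thesis
          using c[of x] by simp
      qed
      then show "w \<in> - Sp T"
        using \<open>c > 0\<close> by (auto simp: Sp_iff[OF assms] intro!: exI[of _ "c / 2"])
    qed (use \<open>c > 0\<close> in simp)
  qed
  ultimately show ?thesis
    by (simp add: compact_eq_bounded_closed closed_def)
qed

text \<open>Let M be the norm. If S - M and S + M were both bounded below, so would be their product
  S^2 - M^2. Expanding the square of that bound by self-adjointness makes the norm of S strictly
  smaller than M.\<close>

lemma norm_in_Sp:
  assumes "selfadjoint S" "S \<noteq> 0"
  shows "complex_of_real (norm S) \<in> Sp S \<or> complex_of_real (- norm S) \<in> Sp S"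
proof (rule ccontr)
  define M where "M = norm S"
  have "M > 0" using assms by (simp add: M_def)
  assume "\<not> (complex_of_real (norm S) \<in> Sp S \<or> complex_of_real (- norm S) \<in> Sp S)"
  then obtain c d where "c > 0" "d > 0"
    and c: "\<And>x. c * norm x \<le> norm (blinfun_apply S x - M *\<^sub>R x)"
    and d: "\<And>x. d * norm x \<le> norm (blinfun_apply S x + M *\<^sub>R x)"
    unfolding M_def Sp_iff[OF assms(1)] by (auto simp flip: scaleR_scaleC)
  \<comment> \<open>The gain that remains when (c d)^2 (norm x)^2 \<le> M^2 (M^2 (norm x)^2 - (norm
    (S x))^2) is divided by M^2.\<close>
  define e where "e = (c * d)\<^sup>2 / M\<^sup>2"
  have "e > 0" using \<open>c > 0\<close> \<open>d > 0\<close> \<open>M > 0\<close> by (simp add: e_def)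
  have *: "(norm (blinfun_apply S x))\<^sup>2 \<le> (M\<^sup>2 - e) * (norm x)\<^sup>2" for x
  proof -
    define y where "y = blinfun_apply S x + M *\<^sub>R x"
    have "c * (d * norm x) \<le> c * norm y"
      using d[of x] \<open>c > 0\<close> by (simp add: y_def)
    also have "\<dots> \<le> norm (blinfun_apply S y - M *\<^sub>R y)"
      by (rule c)
    also have "blinfun_apply S y - M *\<^sub>R y = blinfun_apply S (blinfun_apply S x) - M\<^sup>2 *\<^sub>R x"
      by (simp add: y_def op_apply algebra_simps power2_eq_square)
    finally have "(c * (d * norm x))\<^sup>2 \<le> (norm (blinfun_apply S (blinfun_apply S x) - M\<^sup>2 *\<^sub>R x))\<^sup>2"
      using \<open>c > 0\<close> \<open>d > 0\<close> by (intro power_mono) auto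
    also have "\<dots> = (norm (blinfun_apply S (blinfun_apply S x)))\<^sup>2
        - 2 * (M\<^sup>2 * (norm (blinfun_apply S x))\<^sup>2) + (M\<^sup>2 * norm x)\<^sup>2"
      using selfadjoint_cinner[OF assms(1), of "blinfun_apply S x" x]
      by (simp add: norm_diff_power2 cinner.scaleR_right cinner_self)
    also have "(norm (blinfun_apply S (blinfun_apply S x)))\<^sup>2 \<le> (M * norm (blinfun_apply S x))\<^sup>2"
      unfolding M_def by (intro power_mono norm_blinfun) auto
    finally have "(c * d)\<^sup>2 * (norm x)\<^sup>2 \<le> M\<^sup>2 * (M\<^sup>2 * (norm x)\<^sup>2 - (norm (blinfun_apply S x))\<^sup>2)"
      by (simp add: power_mult_distrib algebra_simps power2_eq_square)
    then have "e * (norm x)\<^sup>2 \<le> M\<^sup>2 * (norm x)\<^sup>2 - (norm (blinfun_apply S x))\<^sup>2"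
      using \<open>M > 0\<close> by (simp add: e_def divide_simps mult.commute)
    then show ?thesis
      by (simp add: algebra_simps)
  qed
  show False
  proof (cases "M\<^sup>2 - e \<ge> 0")
    case True
    have "norm S \<le> sqrt (M\<^sup>2 - e)"
    proof (rule norm_blinfun_bound)
      fix x show "norm (blinfun_apply S x) \<le> sqrt (M\<^sup>2 - e) * norm x"
        using *[of x] True by - (rule power2_le_imp_le, auto simp: power_mult_distrib)
    qed (use True in simp)
    then have "M\<^sup>2 \<le> M\<^sup>2 - e"
      using True \<open>M > 0\<close> by (simp add: M_def real_le_rsqrt sqrt_ge_absD)
    then show False
      using \<open>e > 0\<close> by simp
  next
    case False
    have "blinfun_apply S x = 0" for x
      using *[of x] False
      by (smt (verit) mult_nonneg_nonneg mult_nonpos_nonneg norm_le_zero_iff power2_less_0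
          zero_le_power2 power2_eq_iff_nonneg norm_ge_zero power_zero_numeral)
    then have "S = 0" by (intro blinfun_eqI) (simp add: op_apply)
    then show False using assms by simp
  qed
qed

text \<open>For l < c, pairing T x - l x with x and applying Cauchy-Schwarz shows that T - l is
  bounded below by c - l.\<close>

lemma Sp_lower:
  assumes "selfadjoint T" "\<And>x. c * (norm x)\<^sup>2 \<le> Re (cinner (blinfun_apply T x) x)"
    and "complex_of_real l \<in> Sp T"
  shows "c \<le> l"
proof (rule ccontr)
  assume "\<not> c \<le> l"
  have "(c - l) * norm x \<le> norm (blinfun_apply T x - complex_of_real l *\<^sub>C x)" for x
  proof (cases "x = 0")
    case False
    have "(c - l) * (norm x)\<^sup>2 \<le> Re (cinner (blinfun_apply T x - complex_of_real l *\<^sub>C x) x)"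
      using assms(2)[of x] by (simp add: cinner.diff_left cinner_scaleC_left cinner_self algebra_simps del: of_real_power)
    also have "\<dots> \<le> norm (blinfun_apply T x - complex_of_real l *\<^sub>C x) * norm x"
      by (rule Re_cinner_le)
    finally show ?thesis
      using False by (simp add: power2_eq_square)
  qed simp
  then show False
    using assms(3) \<open>\<not> c \<le> l\<close> unfolding Sp_iff[OF assms(1)] by (metis diff_gt_0_iff_gt not_le)
qed

lemma Sp_uminus: "- z \<in> Sp (- T) \<longleftrightarrow> z \<in> Sp (T :: 'a::complex_hilbert \<Rightarrow>\<^sub>L 'a)"
proof -
  have "invertible_op (- S) \<Longrightarrow> invertible_op S" for S :: "'a \<Rightarrow>\<^sub>L 'a"
  proof -
    assume "invertible_op (- S)"
    then obtain R where "R \<in> BH" "(- S) o\<^sub>L R = id_blinfun" "R o\<^sub>L (- S) = id_blinfun"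
      by (auto simp: invertible_op_def)
    moreover from this have "S o\<^sub>L (0 - R) = id_blinfun" "(0 - R) o\<^sub>L S = id_blinfun"
      by (simp_all add: blinfun_compose.minus_left blinfun_compose.minus_right)
    moreover have "0 - R \<in> BH" using \<open>R \<in> BH\<close> by blast
    ultimately show ?thesis unfolding invertible_op_def by blast
  qed
  from this[of S for S] this[of "- S" for S] have "invertible_op (- S) = invertible_op S" for S :: "'a \<Rightarrow>\<^sub>L 'a"
    by auto
  moreover have "- T - scaleC_op (- z) id_blinfun = - (T - scaleC_op z id_blinfun)"
    by (intro blinfun_eqI) (simp add: op_apply)
  ultimately show ?thesis
    unfolding Sp_def mem_Collect_eq by (simp only:)
qed

lemma Sp_upper:
  assumes "selfadjoint T" "\<And>x. Re (cinner (blinfun_apply T x) x) \<le> c * (norm x)\<^sup>2"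
    and "complex_of_real l \<in> Sp T"
  shows "l \<le> c"
proof -
  have "selfadjoint (- T)"
    using selfadjoint_intros(4)[OF selfadjoint_intros(2) assms(1)] by simp
  then have "- c \<le> - l"
    using assms(2,3) Sp_uminus[of "complex_of_real l" T]
    by - (rule Sp_lower[of "- T"], auto simp: op_apply cinner.minus_left)
  then show ?thesis by simp
qed

section \<open>Polynomials of an operator and their norms\<close>

definition poly_op :: "complex poly \<Rightarrow> ('a::complex_hilbert \<Rightarrow>\<^sub>L 'a) \<Rightarrow> ('a \<Rightarrow>\<^sub>L 'a)" where
  "poly_op p T = fold_coeffs (\<lambda>a S. scaleC_op a id_blinfun + (T o\<^sub>L S)) p 0"

lemma scaleC_op_simps [simp]: "scaleC_op 0 T = 0" "scaleC_op 1 T = T" "scaleC_op c 0 = 0"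
  by (auto intro!: blinfun_eqI simp: op_apply)

lemma poly_op_0 [simp]: "poly_op 0 T = 0"
  by (simp add: poly_op_def)

lemma poly_op_pCons [simp]: "poly_op (pCons a p) T = scaleC_op a id_blinfun + (T o\<^sub>L poly_op p T)"
  by (cases "p = 0 \<and> a = 0") (auto simp: poly_op_def blinfun_compose.zero_right)

lemma poly_op_BH [simp, intro]: "T \<in> BH \<Longrightarrow> poly_op p T \<in> BH"
  by (induction p) auto

lemma poly_op_1 [simp]: "poly_op 1 T = id_blinfun"
  by (simp only: one_pCons poly_op_pCons poly_op_0 blinfun_compose.zero_right scaleC_op_simps add_0_right)

lemma poly_op_add: "poly_op (p + q) T = poly_op p T + poly_op q T"
  by (induction p q rule: poly_induct2)
     (auto intro!: blinfun_eqI simp: op_apply scaleC_add_left algebra_simps)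

lemma poly_op_smult: "T \<in> BH \<Longrightarrow> poly_op (smult c p) T = scaleC_op c (poly_op p T)"
  by (induction p)
     (auto intro!: blinfun_eqI simp: op_apply scaleC_add_right scaleC_scaleC BH_apply)

lemma poly_op_mult: "T \<in> BH \<Longrightarrow> poly_op (p * q) T = poly_op p T o\<^sub>L poly_op q T"
  by (induction p)
     (auto intro!: blinfun_eqI simp: op_apply poly_op_add poly_op_smult blinfun_compose.zero_left)

lemma poly_op_commute:
  "T \<in> BH \<Longrightarrow> R \<in> BH \<Longrightarrow> R o\<^sub>L T = T o\<^sub>L R \<Longrightarrow> R o\<^sub>L poly_op p T = poly_op p T o\<^sub>L R"
proof (induction p)
  case (pCons a p)
  have "blinfun_apply R (blinfun_apply T x) = blinfun_apply T (blinfun_apply R x)"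
     "blinfun_apply R (blinfun_apply (poly_op p T) x) = blinfun_apply (poly_op p T) (blinfun_apply R x)" for x
    using pCons by (metis blinfun_apply_blinfun_compose)+
  then show ?case
    by (intro blinfun_eqI) (simp add: op_apply BH_apply pCons)
qed (simp add: blinfun_compose.zero_left blinfun_compose.zero_right)

lemma is_adjoint_poly_op:
  assumes "selfadjoint T"
  shows "is_adjoint (poly_op p T) (poly_op (map_poly cnj p) T)"
proof (induction p)
  case (pCons a p)
  have "poly_op (map_poly cnj p) T o\<^sub>L T = T o\<^sub>L poly_op (map_poly cnj p) T"
    using assms by (intro poly_op_commute[symmetric]) auto
  moreover have "is_adjoint (T o\<^sub>L poly_op p T) (poly_op (map_poly cnj p) T o\<^sub>L T)"
    using assms pCons by (intro is_adjoint_compose) (auto simp: selfadjoint_def)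
  ultimately show ?case
    by (auto simp: map_poly_pCons intro!: is_adjoint_add is_adjoint_scaleC_op)
qed (simp add: is_adjoint_def op_apply cinner.zero_left cinner.zero_right)

text \<open>Complex coefficients let the polynomial split into linear factors. The factor for a root
  z is T - z, invertible because z avoids the spectrum; one factor is removed per degree.\<close>

lemma invertible_poly_op:
  fixes T :: "'a::complex_hilbert \<Rightarrow>\<^sub>L 'a"
  assumes "T \<in> BH" "p \<noteq> 0" "\<And>z. poly p z = 0 \<Longrightarrow> z \<notin> Sp T"
  shows "invertible_op (poly_op p T)"
  using assms(2,3)
proof (induction "degree p" arbitrary: p)
  case 0
  then obtain a where p: "p = [:a:]" "a \<noteq> 0"
    by (metis degree_0_id pCons_0_0 degree_eq_zeroE)
  have "scaleC_op a id_blinfun o\<^sub>L scaleC_op b id_blinfun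
      = (scaleC_op (a * b) id_blinfun :: 'a \<Rightarrow>\<^sub>L 'a)" for a b
    by (intro blinfun_eqI) (simp add: scaleC_scaleC)
  then show ?case
    using p unfolding invertible_op_def
    by (intro bexI[of _ "scaleC_op (1 / a) id_blinfun"]) (auto simp: blinfun_compose.zero_right)
next
  case (Suc n)
  then have "\<not> constant (poly p)"
    by (simp add: constant_degree)
  then obtain z where "poly p z = 0"
    using fundamental_theorem_of_algebra by blast
  then obtain q where q: "p = [:- z, 1:] * q"
    by (metis poly_eq_0_iff_dvd dvdE)
  with Suc.prems have "q \<noteq> 0" by auto
  have "degree q = n"
    using Suc(2) \<open>q \<noteq> 0\<close> by (simp add: q degree_mult_eq del: mult_pCons_left)
  have "invertible_op (poly_op q T)"
    using Suc \<open>q \<noteq> 0\<close> \<open>degree q = n\<close> by (intro Suc(1)) (auto simp: q)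
  moreover have "poly_op [:- z, 1:] T = T - scaleC_op z id_blinfun"
    by (intro blinfun_eqI) (simp add: op_apply blinfun_compose.zero_right)
  then have "invertible_op (poly_op [:- z, 1:] T)"
    using Suc.prems(2)[OF \<open>poly p z = 0\<close>] by (simp add: Sp_def)
  ultimately show ?case
    unfolding q poly_op_mult[OF assms(1)] by (intro invertible_op_compose)
qed

text \<open>A nonzero self-adjoint operator has its norm or minus its norm in the spectrum, so an
  empty spectrum forces T = 0. Then 0 is invertible and the space is zero. This settles the
  degenerate cases below.\<close>

lemma Sp_empty_imp:
  fixes S T R :: "'a::complex_hilbert \<Rightarrow>\<^sub>L 'a"
  assumes "selfadjoint T" "Sp T = {}"
  shows "S = R"
proof -
  have "T = 0"
    using norm_in_Sp[of T] assms by auto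
  then have "invertible_op (0 :: 'a \<Rightarrow>\<^sub>L 'a)"
    using assms(2) unfolding Sp_def by (auto dest!: spec[of _ 0])
  then have "id_blinfun = (0 :: 'a \<Rightarrow>\<^sub>L 'a)"
    by (auto simp: invertible_op_def blinfun_compose.zero_left)
  then have "x = 0" for x :: 'a
    by (metis id_apply id_blinfun.rep_eq zero_blinfun.rep_eq)
  then show ?thesis
    by (intro blinfun_eqI) metis
qed

text \<open>One inclusion of the spectral mapping theorem: if \<open>p\<close> omits the value
  \<open>w\<close> on the spectrum, then p - w has no zero there and p(T) - w is invertible.\<close>

lemma Sp_poly_op:
  fixes T :: "'a::complex_hilbert \<Rightarrow>\<^sub>L 'a"
  assumes "selfadjoint T" "w \<in> Sp (poly_op p T)"
  shows "\<exists>z\<in>Sp T. poly p z = w"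
proof (rule ccontr)
  assume *: "\<not> ?thesis"
  \<comment> \<open>A polynomial that is constantly \<open>w\<close> omits \<open>w\<close> on the
    spectrum only if the spectrum is empty; on the zero space every operator is invertible, so
    nothing is left in the spectrum of p(T).\<close>
  have "p - [:w:] \<noteq> 0"
  proof
    assume "p - [:w:] = 0"
    then have "Sp T = {}" using * by auto
    then have "poly_op p T - scaleC_op w id_blinfun = id_blinfun"
      by (rule Sp_empty_imp[OF assms(1)])
    moreover have "invertible_op (id_blinfun :: 'a \<Rightarrow>\<^sub>L 'a)"
      by (auto simp: invertible_op_def intro!: bexI[of _ id_blinfun] blinfun_eqI)
    ultimately show False using assms(2) by (simp add: Sp_def)
  qed
  then have "invertible_op (poly_op (p - [:w:]) T)"
    using assms(1) * by (intro invertible_poly_op) auto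
  moreover have "poly_op p T = poly_op (p - [:w:]) T + scaleC_op w id_blinfun"
    using poly_op_add[of "p - [:w:]" "[:w:]" T] by (simp add: blinfun_compose.zero_right)
  ultimately show False
    using assms(2) by (simp add: Sp_def)
qed

text \<open>The C*-identity reduces the bound to the self-adjoint operator Q = p(T)* p(T). The norm
  of Q is the modulus of one of its spectral points, and such a point is the square of the modulus
  of p at a point of \<open>Sp T\<close>.\<close>

lemma norm_poly_op_le:
  assumes "selfadjoint T" "r \<ge> 0" "\<And>z. z \<in> Sp T \<Longrightarrow> cmod (poly p z) \<le> r"
  shows "norm (poly_op p T) \<le> r"
proof -
  define p' where "p' = map_poly cnj p"
  define Q where "Q = poly_op (p' * p) T"
  have adj: "is_adjoint (poly_op p T) (poly_op p' T)"
    unfolding p'_def by (rule is_adjoint_poly_op[OF assms(1)])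
  have Q: "Q = poly_op p' T o\<^sub>L poly_op p T"
    unfolding Q_def using assms(1) by (intro poly_op_mult) auto
  have "selfadjoint Q"
    using is_adjoint_compose[OF is_adjoint_sym[OF adj] adj] assms(1)
    by (simp add: selfadjoint_def Q)
  have "norm Q \<le> r\<^sup>2"
  proof (cases "Q = 0")
    case False
    then obtain w where "w \<in> Sp Q" "cmod w = norm Q"
      using norm_in_Sp[OF \<open>selfadjoint Q\<close>] by (metis norm_minus_cancel norm_of_real abs_norm_cancel of_real_minus)
    then obtain z where z: "z \<in> Sp T" "cmod (poly (p' * p) z) = norm Q"
      using Sp_poly_op[OF assms(1)] unfolding Q_def by blast
    \<comment> \<open>The spectrum is real, so conjugating the coefficients conjugates the
      value.\<close>
    have "cnj z = z"
      using Sp_Im[OF assms(1) z(1)] by (simp add: complex_eq_iff)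
    then have "poly p' z = cnj (poly p z)"
      unfolding p'_def by (induction p) (auto simp: map_poly_pCons)
    then have "norm Q = (cmod (poly p z))\<^sup>2"
      using z(2) by (simp add: norm_mult power2_eq_square)
    also have "\<dots> \<le> r\<^sup>2"
      using assms(3)[OF z(1)] by (intro power_mono) auto
    finally show ?thesis .
  qed simp
  show ?thesis
  proof (rule norm_blinfun_bound)
    fix x
    have "(norm (blinfun_apply (poly_op p T) x))\<^sup>2 = Re (cinner x (blinfun_apply Q x))"
      using arg_cong[OF is_adjoint_apply[OF adj, of x "blinfun_apply (poly_op p T) x"], of Re]
      by (simp add: Q cinner_self del: of_real_power)
    also have "\<dots> \<le> norm x * (norm Q * norm x)"
      using Re_cinner_le[of x "blinfun_apply Q x"] norm_blinfun[of Q x]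
      by (meson mult_left_mono norm_ge_zero order_trans)
    also have "\<dots> \<le> norm x * (r\<^sup>2 * norm x)"
      using \<open>norm Q \<le> r\<^sup>2\<close> by (intro mult_left_mono mult_right_mono) auto
    finally show "norm (blinfun_apply (poly_op p T) x) \<le> r * norm x"
      using \<open>r \<ge> 0\<close> by - (rule power2_le_imp_le, auto simp: power2_eq_square algebra_simps)
  qed fact
qed

section \<open>The continuous functional calculus\<close>

text \<open>Brings what the Stone-Weierstrass theorem delivers into the form to which
  \<open>poly_op\<close> applies.\<close>

lemma real_polynomial_function_poly:
  fixes h :: "real \<Rightarrow> real"
  assumes "real_polynomial_function h"
  shows "\<exists>p. \<forall>x. poly p (complex_of_real x) = complex_of_real (h x)"
  using assms
proof (induction rule: real_polynomial_function.induct)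
  case (linear f)
  have "f x = x * f 1" for x
    using linear_scale[OF bounded_linear.linear[OF linear], of x 1] by simp
  then show ?case
    by (intro exI[of _ "[:0, complex_of_real (f 1):]"]) (metis mult.commute mult_zero_left
      poly_pCons poly_0 add_0 add_0_right mult_zero_right of_real_mult)
next
  case (const c)
  show ?case
    by (intro exI[of _ "[:complex_of_real c:]"]) simp
next
  case (add f g)
  then show ?case
    by (metis poly_add of_real_add)
next
  case (mult f g)
  then show ?case
    by (metis poly_mult of_real_mult)
qed

text \<open>\<open>K\<close> is a compact subset of the real axis, so the Weierstrass theorem
  handles the real and the imaginary part of \<open>g\<close> separately; the two polynomials are
  joined with the factor i.\<close>

lemma ex_poly_uniform_limit:
  assumes "compact K" "\<And>z. z \<in> K \<Longrightarrow> Im z = 0" "continuous_on K g"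
  shows "\<exists>p. uniform_limit K (\<lambda>n. poly (p n)) g sequentially"
proof -
  have approx: "\<exists>p. \<forall>z\<in>K. cmod (poly p z - of_real (h z)) \<le> e"
    if "continuous_on K h" "e > 0" for h :: "complex \<Rightarrow> real" and e
  proof -
    have K: "complex_of_real x \<in> K" if "x \<in> Re ` K" for x
    proof -
      from that obtain z where z: "z \<in> K" "x = Re z" by blast
      then have "complex_of_real x = z"
        using assms(2) by (simp add: complex_eq_iff)
      with z show ?thesis by simp
    qed
    have "compact (Re ` K)"
      using assms(1) by (intro compact_continuous_image continuous_intros)
    moreover have "continuous_on (Re ` K) (\<lambda>x. h (complex_of_real x))"
      using K by (intro continuous_on_compose2[OF that(1)] continuous_intros) auto
    ultimately obtain q where "real_polynomial_function q"
      and q: "\<And>x. x \<in> Re ` K \<Longrightarrow> \<bar>h (complex_of_real x) - q x\<bar> < e"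
      using \<open>e > 0\<close> by (rule Stone_Weierstrass_real_polynomial_function) blast
    obtain p where p: "\<And>x. poly p (complex_of_real x) = complex_of_real (q x)"
      using real_polynomial_function_poly[OF \<open>real_polynomial_function q\<close>] by blast
    show ?thesis
    proof (intro exI[of _ p] ballI)
      fix z assume "z \<in> K"
      then have z: "complex_of_real (Re z) = z"
        using assms(2) by (simp add: complex_eq_iff)
      have "poly p z - of_real (h z) = of_real (q (Re z) - h z)"
        using p[of "Re z"] z by simp
      then have "cmod (poly p z - of_real (h z)) = \<bar>q (Re z) - h z\<bar>"
        by (simp only: norm_of_real)
      with q[of "Re z"] \<open>z \<in> K\<close> z show "cmod (poly p z - of_real (h z)) \<le> e"
        by simp
    qed
  qed
  have "\<exists>p. \<forall>z\<in>K. cmod (poly p z - g z) \<le> inverse (real (Suc n))" for n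
  proof -
    let ?e = "inverse (real (Suc n)) / 2"
    obtain p where p: "\<And>z. z \<in> K \<Longrightarrow> cmod (poly p z - of_real (Re (g z))) \<le> ?e"
      using approx[of "\<lambda>z. Re (g z)" ?e] assms(3) by (auto intro: continuous_intros)
    obtain q where q: "\<And>z. z \<in> K \<Longrightarrow> cmod (poly q z - of_real (Im (g z))) \<le> ?e"
      using approx[of "\<lambda>z. Im (g z)" ?e] assms(3) by (auto intro: continuous_intros)
    have "cmod (poly (p + smult \<i> q) z - g z) \<le> inverse (real (Suc n))" if "z \<in> K" for z
    proof -
      have "poly (p + smult \<i> q) z - g z
          = (poly p z - of_real (Re (g z))) + \<i> * (poly q z - of_real (Im (g z)))"
        by (subst (2) complex_eq) (simp add: algebra_simps)
      then have "cmod (poly (p + smult \<i> q) z - g z)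
          \<le> cmod (poly p z - of_real (Re (g z))) + cmod (\<i> * (poly q z - of_real (Im (g z))))"
        by (metis norm_triangle_ineq)
      with p[OF that] q[OF that] show ?thesis
        by (simp add: norm_mult)
    qed
    then show ?thesis by blast
  qed
  then obtain p where p: "\<And>n z. z \<in> K \<Longrightarrow> cmod (poly (p n) z - g z) \<le> inverse (real (Suc n))"
    by metis
  have "uniform_limit K (\<lambda>n. poly (p n)) g sequentially"
  proof (rule uniform_limitI)
    fix e :: real assume "e > 0"
    then obtain N where N: "inverse (real (Suc N)) < e"
      using reals_Archimedean by blast
    show "\<forall>\<^sub>F n in sequentially. \<forall>z\<in>K. dist (poly (p n) z) (g z) < e"
      using eventually_ge_at_top[of N]
    proof eventually_elim
      case (elim n)
      then have "inverse (real (Suc n)) \<le> inverse (real (Suc N))"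
        by (intro le_imp_inverse_le) auto
      with N p show ?case
        by (metis dist_norm order.strict_trans1)
    qed
  qed
  then show ?thesis by blast
qed

lemma poly_fun_simps:
  fixes p q :: "complex poly"
  shows
  "poly (p + q) = (\<lambda>x. poly p x + poly q x)" "poly (p - q) = (\<lambda>x. poly p x - poly q x)"
  "poly (p * q) = (\<lambda>x. poly p x * poly q x)" "poly (smult c p) = (\<lambda>x. c * poly p x)"
  by auto

lemma poly_op_diff: "poly_op (p - q) T = poly_op p T - poly_op q T"
  using poly_op_add[of "p - q" q T] by simp

lemma tendsto_poly_op_0:
  assumes "selfadjoint T" "uniform_limit (Sp T) (\<lambda>n. poly (p n)) (\<lambda>_. 0) F"
  shows "((\<lambda>n. poly_op (p n) T) \<longlongrightarrow> 0) F"
proof (rule tendstoI)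
  fix e :: real assume "e > 0"
  then have "\<forall>\<^sub>F n in F. \<forall>z\<in>Sp T. dist (poly (p n) z) 0 < e / 2"
    using uniform_limitD[OF assms(2), of "e / 2"] by simp
  then show "\<forall>\<^sub>F n in F. dist (poly_op (p n) T) 0 < e"
  proof eventually_elim
    case (elim n)
    then have "norm (poly_op (p n) T) \<le> e / 2"
      using \<open>e > 0\<close> by (intro norm_poly_op_le[OF assms(1)]) (auto intro: less_imp_le)
    then show ?case using \<open>e > 0\<close> by simp
  qed
qed

text \<open>The value is the common limit along all approximating sequences, so no choice of a
  sequence enters and only the restriction of \<open>g\<close> to the spectrum matters. The norm
  bound for polynomials makes these limits exist and agree.\<close>

definition cfc :: "('a::complex_hilbert \<Rightarrow>\<^sub>L 'a) \<Rightarrow> (complex \<Rightarrow> complex) \<Rightarrow> ('a \<Rightarrow>\<^sub>L 'a)" where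
  "cfc T g = (THE S. \<forall>p. uniform_limit (Sp T) (\<lambda>n. poly (p n)) g sequentially
                \<longrightarrow> (\<lambda>n. poly_op (p n) T) \<longlonglongrightarrow> S)"

lemma ex_poly_seq_Sp:
  "selfadjoint T \<Longrightarrow> continuous_on (Sp T) g \<Longrightarrow>
    \<exists>p. uniform_limit (Sp T) (\<lambda>n. poly (p n)) g sequentially"
  by (intro ex_poly_uniform_limit compact_Sp) (auto intro: Sp_Im)

lemma continuous_on_poly_complex [continuous_intros]:
  "continuous_on S (poly (p :: complex poly))"
  by (simp add: continuous_at_imp_continuous_on)

lemma poly_op_tendsto_cfc:
  assumes T: "selfadjoint T" and p: "uniform_limit (Sp T) (\<lambda>n. poly (p n)) g sequentially"
  shows "(\<lambda>n. poly_op (p n) T) \<longlonglongrightarrow> cfc T g"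
proof -
  have diff: "(\<lambda>n. poly_op (q n) T - poly_op (p n) T) \<longlonglongrightarrow> 0"
    if "uniform_limit (Sp T) (\<lambda>n. poly (q n)) g sequentially" for q
    using tendsto_poly_op_0[OF T, of "\<lambda>n. q n - p n"] uniform_limit_minus[OF that p]
    by (simp add: poly_op_diff poly_fun_simps)
  have "Cauchy (\<lambda>n. poly_op (p n) T)"
  proof (rule metric_CauchyI)
    fix e :: real assume "e > 0"
    then have "\<forall>\<^sub>F n in sequentially. \<forall>z\<in>Sp T. dist (poly (p n) z) (g z) < e / 4"
      using uniform_limitD[OF p, of "e / 4"] by simp
    then obtain N where N: "\<And>n z. n \<ge> N \<Longrightarrow> z \<in> Sp T \<Longrightarrow> dist (poly (p n) z) (g z) < e / 4"
      by (auto simp: eventually_sequentially)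
    have "dist (poly_op (p m) T) (poly_op (p n) T) < e" if "m \<ge> N" "n \<ge> N" for m n
    proof -
      have "norm (poly_op (p m - p n) T) \<le> e / 2"
      proof (rule norm_poly_op_le[OF T])
        fix z assume "z \<in> Sp T"
        with N that have "dist (poly (p m) z) (poly (p n) z) < e / 4 + e / 4"
          by (meson dist_triangle_less_add)
        then show "cmod (poly (p m - p n) z) \<le> e / 2"
          by (simp add: dist_norm)
      qed (use \<open>e > 0\<close> in simp)
      then show ?thesis
        using \<open>e > 0\<close> by (simp add: poly_op_diff dist_norm)
    qed
    then show "\<exists>M. \<forall>m\<ge>M. \<forall>n\<ge>M. dist (poly_op (p m) T) (poly_op (p n) T) < e"
      by blast
  qed
  then obtain S where S: "(\<lambda>n. poly_op (p n) T) \<longlonglongrightarrow> S"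
    by (auto simp: Cauchy_convergent_iff convergent_def)
  have "cfc T g = S"
    unfolding cfc_def
  proof (rule the_equality)
    show "\<forall>q. uniform_limit (Sp T) (\<lambda>n. poly (q n)) g sequentially
        \<longrightarrow> (\<lambda>n. poly_op (q n) T) \<longlonglongrightarrow> S"
      using tendsto_add[OF diff S] by simp
    show "R = S" if "\<forall>q. uniform_limit (Sp T) (\<lambda>n. poly (q n)) g sequentially
        \<longrightarrow> (\<lambda>n. poly_op (q n) T) \<longlonglongrightarrow> R" for R
      using that p S LIMSEQ_unique by blast
  qed
  with S show ?thesis by simp
qed

lemma cfc_eqI:
  assumes "selfadjoint T" "uniform_limit (Sp T) (\<lambda>n. poly (p n)) g sequentially"
    and "(\<lambda>n. poly_op (p n) T) \<longlonglongrightarrow> S"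
  shows "cfc T g = S"
  using LIMSEQ_unique poly_op_tendsto_cfc[OF assms(1,2)] assms(3) by blast

lemma cfc_poly: "selfadjoint T \<Longrightarrow> cfc T (poly p) = poly_op p T"
  by (rule cfc_eqI[where p = "\<lambda>_. p"]) (auto intro: uniform_limit_const)

section \<open>Passage from polynomials to continuous functions\<close>

lemma BH_tendsto:
  assumes "(X \<longlongrightarrow> S) F" "\<forall>\<^sub>F n in F. X n \<in> BH" "F \<noteq> bot"
  shows "S \<in> BH"
proof -
  have "blinfun_apply S (c *\<^sub>C x) = c *\<^sub>C blinfun_apply S x" for c x
  proof (rule tendsto_unique[OF assms(3)])
    show "((\<lambda>n. blinfun_apply (X n) (c *\<^sub>C x)) \<longlongrightarrow> blinfun_apply S (c *\<^sub>C x)) F"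
      by (intro tendsto_intros assms)
    have "((\<lambda>n. c *\<^sub>C blinfun_apply (X n) x) \<longlongrightarrow> c *\<^sub>C blinfun_apply S x) F"
      by (intro bounded_linear.tendsto[OF bounded_linear_scaleC] tendsto_intros assms)
    then show "((\<lambda>n. blinfun_apply (X n) (c *\<^sub>C x)) \<longlongrightarrow> c *\<^sub>C blinfun_apply S x) F"
      by (rule Lim_transform_eventually)
         (use assms(2) in eventually_elim, simp add: BH_apply)
  qed
  then show ?thesis by (simp add: BH_def)
qed

lemma is_adjoint_tendsto:
  assumes "(X \<longlongrightarrow> S) F" "(Y \<longlongrightarrow> R) F" "\<And>n. is_adjoint (X n) (Y n)" "F \<noteq> bot"
  shows "is_adjoint S R"
  unfolding is_adjoint_def
proof (intro allI)
  fix x y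
  have "((\<lambda>n. cinner (blinfun_apply (X n) x) y) \<longlongrightarrow> cinner (blinfun_apply S x) y) F"
    by (intro cinner.tendsto tendsto_intros assms)
  moreover have "((\<lambda>n. cinner x (blinfun_apply (Y n) y)) \<longlongrightarrow> cinner x (blinfun_apply R y)) F"
    by (intro cinner.tendsto tendsto_intros assms)
  ultimately show "cinner (blinfun_apply S x) y = cinner x (blinfun_apply R y)"
    using is_adjoint_apply[OF assms(3)] tendsto_unique[OF assms(4)] by simp
qed

lemma bounded_linear_scaleC_op: "bounded_linear (scaleC_op c)"
proof (rule bounded_linear_intro[where K = "cmod c"])
  show "norm (scaleC_op c T) \<le> norm T * cmod c" for T
    using norm_scaleC_op[of c T] by (simp add: mult.commute)
qed (auto intro!: blinfun_eqI simp: op_apply scaleC_add_right scaleR_scaleC scaleC_scaleC mult.commute)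

lemma
  assumes T: "selfadjoint T" and g: "continuous_on (Sp T) g"
  shows cfc_BH: "cfc T g \<in> BH"
    and cfc_scale: "cfc T (\<lambda>z. c * g z) = scaleC_op c (cfc T g)"
    and cfc_adjoint: "is_adjoint (cfc T g) (cfc T (\<lambda>z. cnj (g z)))"
    and norm_cfc_le: "r \<ge> 0 \<Longrightarrow> (\<And>z. z \<in> Sp T \<Longrightarrow> cmod (g z) \<le> r) \<Longrightarrow> norm (cfc T g) \<le> r"
proof -
  obtain p where p: "uniform_limit (Sp T) (\<lambda>n. poly (p n)) g sequentially"
    using ex_poly_seq_Sp[OF T g] by blast
  note lim = poly_op_tendsto_cfc[OF T p]
  show "cfc T g \<in> BH"
    using T by (intro BH_tendsto[OF lim]) auto
  show "cfc T (\<lambda>z. c * g z) = scaleC_op c (cfc T g)"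
  proof (rule cfc_eqI[OF T])
    show "uniform_limit (Sp T) (\<lambda>n. poly (smult c (p n))) (\<lambda>z. c * g z) sequentially"
      using bounded_linear.uniform_limit[OF bounded_linear_mult_right p, of c]
      by (simp add: poly_fun_simps)
    show "(\<lambda>n. poly_op (smult c (p n)) T) \<longlonglongrightarrow> scaleC_op c (cfc T g)"
      using bounded_linear.tendsto[OF bounded_linear_scaleC_op lim, of c] T
      by (simp add: poly_op_smult)
  qed
  show "is_adjoint (cfc T g) (cfc T (\<lambda>z. cnj (g z)))"
  proof (rule is_adjoint_tendsto[OF lim])
    have "uniform_limit (Sp T) (\<lambda>n z. cnj (poly (p n) z)) (\<lambda>z. cnj (g z)) sequentially"
      by (rule bounded_linear.uniform_limit[OF bounded_linear_cnj p])
    \<comment> \<open>On the real spectrum the conjugated approximants are again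
      polynomials.\<close>
    moreover have "cnj (poly q z) = poly (map_poly cnj q) z" if "z \<in> Sp T" for q z
    proof -
      have "cnj z = z"
        using Sp_Im[OF T that] by (simp add: complex_eq_iff)
      then show ?thesis
        by (induction q) (auto simp: map_poly_pCons)
    qed
    ultimately have "uniform_limit (Sp T) (\<lambda>n. poly (map_poly cnj (p n))) (\<lambda>z. cnj (g z)) sequentially"
      by (subst (asm) uniform_limit_cong'[where g = "\<lambda>n. poly (map_poly cnj (p n))" and i = "\<lambda>z. cnj (g z)"]) auto
    then show "(\<lambda>n. poly_op (map_poly cnj (p n)) T) \<longlonglongrightarrow> cfc T (\<lambda>z. cnj (g z))"
      by (rule poly_op_tendsto_cfc[OF T])
  qed (auto intro: is_adjoint_poly_op[OF T])
  show "norm (cfc T g) \<le> r" if "r \<ge> 0" "\<And>z. z \<in> Sp T \<Longrightarrow> cmod (g z) \<le> r"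
  \<comment> \<open>The approximants obey the bound only up to an arbitrarily small error.\<close>
  proof (rule field_le_epsilon)
    fix e :: real assume "e > 0"
    show "norm (cfc T g) \<le> r + e"
    proof (rule tendsto_upperbound[OF tendsto_norm[OF lim]])
      show "\<forall>\<^sub>F n in sequentially. norm (poly_op (p n) T) \<le> r + e"
        using uniform_limitD[OF p \<open>e > 0\<close>]
      proof eventually_elim
        case (elim n)
        show ?case
        proof (rule norm_poly_op_le[OF T])
          fix z assume "z \<in> Sp T"
          then show "cmod (poly (p n) z) \<le> r + e"
            using elim that(2)[of z] norm_triangle_ineq2[of "poly (p n) z" "g z"]
            by (force simp: dist_norm)
        qed (use \<open>e > 0\<close> that in simp)
      qed
    qed simp
  qed
qed

lemma
  assumes T: "selfadjoint T" and g: "continuous_on (Sp T) g" and h: "continuous_on (Sp T) h"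
  shows cfc_add: "cfc T (\<lambda>z. g z + h z) = cfc T g + cfc T h"
    and cfc_mult: "cfc T (\<lambda>z. g z * h z) = cfc T g o\<^sub>L cfc T h"
proof -
  obtain p where p: "uniform_limit (Sp T) (\<lambda>n. poly (p n)) g sequentially"
    using ex_poly_seq_Sp[OF T g] by blast
  obtain q where q: "uniform_limit (Sp T) (\<lambda>n. poly (q n)) h sequentially"
    using ex_poly_seq_Sp[OF T h] by blast
  note lim = poly_op_tendsto_cfc[OF T p] poly_op_tendsto_cfc[OF T q]
  show "cfc T (\<lambda>z. g z + h z) = cfc T g + cfc T h"
    using uniform_limit_add[OF p q] tendsto_add[OF lim]
    by (intro cfc_eqI[OF T, where p = "\<lambda>n. p n + q n"]) (simp_all add: poly_op_add poly_fun_simps)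
  \<comment> \<open>Uniform limits may be multiplied when the limit functions are bounded.\<close>
  have "bounded (g ` Sp T)" "bounded (h ` Sp T)"
    using compact_continuous_image[OF _ compact_Sp[OF T]] g h compact_imp_bounded by blast+
  then show "cfc T (\<lambda>z. g z * h z) = cfc T g o\<^sub>L cfc T h"
    using uniform_lim_mult[OF p q] blinfun_compose.tendsto[OF lim] T
    by (intro cfc_eqI[OF T, where p = "\<lambda>n. p n * q n"]) (simp_all add: poly_op_mult poly_fun_simps)
qed

lemma continuous_functional_calculus_cfc:
  assumes T: "selfadjoint T"
  shows "continuous_functional_calculus T (cfc T)"
  unfolding continuous_functional_calculus_def
proof (intro conjI allI impI)
  have "poly 1 = (\<lambda>z :: complex. 1)" by auto
  then show "cfc T (\<lambda>z. 1) = id_blinfun"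
    using cfc_poly[OF T, of 1] by simp
  have "poly [:0, 1:] = (\<lambda>z :: complex. z)" by auto
  then show "cfc T (\<lambda>z. z) = T"
    using cfc_poly[OF T, of "[:0, 1:]"]
    by (auto intro!: blinfun_eqI simp: blinfun_compose.zero_right)
qed (use cfc_BH[OF T] cfc_add[OF T] cfc_mult[OF T] cfc_scale[OF T] cfc_adjoint[OF T] norm_cfc_le[OF T] in auto)

text \<open>The homomorphism laws fix \<open>F\<close> on polynomials, and contractivity turns
  uniform approximation on the spectrum into norm approximation. This makes the definite description
  in \<open>fun_op\<close> denote.\<close>

lemma continuous_functional_calculus_unique:
  assumes T: "selfadjoint T" and F: "continuous_functional_calculus T F"
    and g: "continuous_on (Sp T) g"
  shows "F g = cfc T g"
proof -
  have F_one: "F (\<lambda>z. 1) = id_blinfun" and F_id: "F (\<lambda>z. z) = T"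
    and F_add: "\<And>g h. continuous_on (Sp T) g \<Longrightarrow> continuous_on (Sp T) h \<Longrightarrow>
      F (\<lambda>z. g z + h z) = F g + F h"
    and F_mult: "\<And>g h. continuous_on (Sp T) g \<Longrightarrow> continuous_on (Sp T) h \<Longrightarrow>
      F (\<lambda>z. g z * h z) = F g o\<^sub>L F h"
    and F_scale: "\<And>c g. continuous_on (Sp T) g \<Longrightarrow> F (\<lambda>z. c * g z) = scaleC_op c (F g)"
    and F_norm: "\<And>g r. continuous_on (Sp T) g \<Longrightarrow> r \<ge> 0 \<Longrightarrow>
      (\<forall>z\<in>Sp T. cmod (g z) \<le> r) \<Longrightarrow> norm (F g) \<le> r"
    using F unfolding continuous_functional_calculus_def by blast+
  have poly: "F (poly p) = poly_op p T" for p
  proof (induction p)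
    case 0
    have "poly 0 = (\<lambda>z :: complex. 0 * 1)" by auto
    then show ?case
      using F_scale[of "\<lambda>_. 1" 0] by simp
  next
    case (pCons a p)
    have "poly (pCons a p) = (\<lambda>z. a * 1 + z * poly p z)" by auto
    then have "F (poly (pCons a p)) = F (\<lambda>z. a * 1 + z * poly p z)" by simp
    also have "\<dots> = F (\<lambda>z. a * 1) + F (\<lambda>z. z * poly p z)"
      by (rule F_add) (intro continuous_intros)+
    also have "F (\<lambda>z. a * 1) = scaleC_op a id_blinfun"
      using F_scale[of "\<lambda>_. 1" a] by (simp add: F_one)
    also have "F (\<lambda>z. z * poly p z) = T o\<^sub>L F (poly p)"
      using F_mult[of "\<lambda>z. z" "poly p"] by (simp add: F_id continuous_on_poly_complex)
    finally show ?case using pCons by simp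
  qed
  obtain p where p: "uniform_limit (Sp T) (\<lambda>n. poly (p n)) g sequentially"
    using ex_poly_seq_Sp[OF T g] by blast
  have le: "norm (poly_op q T - F g) \<le> e" if "e \<ge> 0" "\<And>z. z \<in> Sp T \<Longrightarrow> cmod (poly q z - g z) \<le> e" for q e
  proof -
    \<comment> \<open>The difference is written as a sum with a multiple, because the specification
      of \<open>F\<close> speaks of sums and scalar multiples.\<close>
    have "F (\<lambda>z. poly q z + - 1 * g z) = F (poly q) + F (\<lambda>z. - 1 * g z)"
      by (rule F_add) (intro continuous_intros g)+
    also have "F (\<lambda>z. - 1 * g z) = scaleC_op (- 1) (F g)"
      by (rule F_scale[OF g])
    also have "scaleC_op (- 1) (F g) = - F g"
      by (intro blinfun_eqI) (simp add: op_apply)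
    finally have "poly_op q T - F g = F (\<lambda>z. poly q z + - 1 * g z)"
      by (simp add: poly)
    moreover have "norm (F (\<lambda>z. poly q z + - 1 * g z)) \<le> e"
      using that by (intro F_norm continuous_intros g) auto
    ultimately show ?thesis by simp
  qed
  have "(\<lambda>n. poly_op (p n) T) \<longlonglongrightarrow> F g"
  proof (rule tendstoI)
    fix e :: real assume "e > 0"
    then have "\<forall>\<^sub>F n in sequentially. \<forall>z\<in>Sp T. dist (poly (p n) z) (g z) < e / 2"
      using uniform_limitD[OF p, of "e / 2"] by simp
    then show "\<forall>\<^sub>F n in sequentially. dist (poly_op (p n) T) (F g) < e"
    proof eventually_elim
      case (elim n)
      then have "norm (poly_op (p n) T - F g) \<le> e / 2"
        using \<open>e > 0\<close> by (intro le) (auto simp: dist_norm intro: less_imp_le)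
      then show ?case using \<open>e > 0\<close> by (simp add: dist_norm)
    qed
  qed
  then show ?thesis
    using cfc_eqI[OF T p] by simp
qed

lemma fun_op_eq_cfc:
  assumes "selfadjoint T" "continuous_on (Sp T) (\<lambda>z. complex_of_real (f (Re z)))"
  shows "fun_op f T = cfc T (\<lambda>z. complex_of_real (f (Re z)))"
  unfolding fun_op_def
proof (rule the_equality)
  show "\<exists>F. continuous_functional_calculus T F \<and>
      cfc T (\<lambda>z. complex_of_real (f (Re z))) = F (\<lambda>z. complex_of_real (f (Re z)))"
    using continuous_functional_calculus_cfc[OF assms(1)] by blast
  show "S = cfc T (\<lambda>z. complex_of_real (f (Re z)))"
    if "\<exists>F. continuous_functional_calculus T F \<and> S = F (\<lambda>z. complex_of_real (f (Re z)))" for S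
    using that continuous_functional_calculus_unique[OF assms(1) _ assms(2)] by blast
qed

lemma cfc_tendsto:
  assumes T: "selfadjoint T" and "\<And>n. continuous_on (Sp T) (h n)" "continuous_on (Sp T) g"
    and lim: "uniform_limit (Sp T) h g F"
  shows "((\<lambda>n. cfc T (h n)) \<longlongrightarrow> cfc T g) F"
proof (rule tendstoI)
  fix e :: real assume "e > 0"
  then have "\<forall>\<^sub>F n in F. \<forall>z\<in>Sp T. dist (h n z) (g z) < e / 2"
    using uniform_limitD[OF lim, of "e / 2"] by simp
  then show "\<forall>\<^sub>F n in F. dist (cfc T (h n)) (cfc T g) < e"
  proof eventually_elim
    case (elim n)
    have "cfc T (\<lambda>z. h n z - g z) + cfc T g = cfc T (h n)"
      using assms by (subst cfc_add[symmetric]) (auto intro: continuous_intros)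
    moreover have "norm (cfc T (\<lambda>z. h n z - g z)) \<le> e / 2"
      using elim \<open>e > 0\<close> assms
      by (intro norm_cfc_le) (auto simp: dist_norm intro: continuous_intros less_imp_le)
    ultimately show ?case
      using \<open>e > 0\<close> by (metis add_diff_cancel_right' dist_norm field_sum_of_halves less_add_same_cancel1 order.strict_trans1 half_gt_zero)
  qed
qed

section \<open>Real functions of self-adjoint operators\<close>

definition real_spectrum :: "('a::complex_hilbert \<Rightarrow>\<^sub>L 'a) \<Rightarrow> real set" where
  "real_spectrum T = {x. complex_of_real x \<in> Sp T}"

lemma Sp_eq_real_spectrum: "selfadjoint T \<Longrightarrow> Sp T = complex_of_real ` real_spectrum T"
proof (intro subset_antisym subsetI)
  fix z assume "selfadjoint T" "z \<in> Sp T"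
  then have "z = complex_of_real (Re z)"
    by (simp add: Sp_Im complex_eq_iff)
  with \<open>z \<in> Sp T\<close> show "z \<in> complex_of_real ` real_spectrum T"
    unfolding real_spectrum_def by (metis image_eqI mem_Collect_eq)
qed (auto simp: real_spectrum_def)

lemma compact_real_spectrum: "selfadjoint T \<Longrightarrow> compact (real_spectrum T)"
proof -
  assume T: "selfadjoint T"
  have "real_spectrum T = Re ` Sp T"
    unfolding Sp_eq_real_spectrum[OF T] by (simp add: image_image)
  then show ?thesis
    using compact_Sp[OF T] by (auto intro!: compact_continuous_image continuous_intros)
qed

lemma continuous_on_Sp:
  assumes "selfadjoint T" "continuous_on (real_spectrum T) f"
  shows "continuous_on (Sp T) (\<lambda>z. complex_of_real (f (Re z)))"
  using assms(2) unfolding Sp_eq_real_spectrum[OF assms(1)]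
  by (intro continuous_on_of_real continuous_on_compose2[OF assms(2)] continuous_intros) auto

lemma fun_op_eq:
  assumes "selfadjoint T" "continuous_on (real_spectrum T) f"
  shows "fun_op f T = cfc T (\<lambda>z. complex_of_real (f (Re z)))"
  by (intro fun_op_eq_cfc continuous_on_Sp assms)

lemma fun_op_selfadjoint [intro]:
  assumes "selfadjoint T" "continuous_on (real_spectrum T) f"
  shows "selfadjoint (fun_op f T)"
  using cfc_BH[OF assms(1) continuous_on_Sp[OF assms]] cfc_adjoint[OF assms(1) continuous_on_Sp[OF assms]]
  by (simp add: fun_op_eq[OF assms] selfadjoint_def)

lemma fun_op_add:
  assumes "selfadjoint T" "continuous_on (real_spectrum T) f" "continuous_on (real_spectrum T) g"
  shows "fun_op (\<lambda>x. f x + g x) T = fun_op f T + fun_op g T"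
  using cfc_add[OF assms(1) continuous_on_Sp[OF assms(1,2)] continuous_on_Sp[OF assms(1,3)]]
  by (simp add: fun_op_eq assms continuous_on_add)

lemma fun_op_mult:
  assumes "selfadjoint T" "continuous_on (real_spectrum T) f" "continuous_on (real_spectrum T) g"
  shows "fun_op (\<lambda>x. f x * g x) T = fun_op f T o\<^sub>L fun_op g T"
  using cfc_mult[OF assms(1) continuous_on_Sp[OF assms(1,2)] continuous_on_Sp[OF assms(1,3)]]
  by (simp add: fun_op_eq assms continuous_on_mult)

lemma fun_op_scale:
  assumes "selfadjoint T" "continuous_on (real_spectrum T) f"
  shows "fun_op (\<lambda>x. c * f x) T = c *\<^sub>R fun_op f T"
  using cfc_scale[OF assms(1) continuous_on_Sp[OF assms], of "complex_of_real c"]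
  by (simp add: fun_op_eq assms continuous_on_mult continuous_on_const scaleC_op_of_real)

lemma norm_fun_op_le:
  assumes "selfadjoint T" "continuous_on (real_spectrum T) f" "r \<ge> 0"
    and "\<And>x. x \<in> real_spectrum T \<Longrightarrow> \<bar>f x\<bar> \<le> r"
  shows "norm (fun_op f T) \<le> r"
  unfolding fun_op_eq[OF assms(1,2)]
  using assms(4) Sp_eq_real_spectrum[OF assms(1)]
  by (intro norm_cfc_le[OF assms(1) continuous_on_Sp[OF assms(1,2)] assms(3)]) auto

lemma fun_op_minus:
  assumes "selfadjoint T" "continuous_on (real_spectrum T) f" "continuous_on (real_spectrum T) g"
  shows "fun_op (\<lambda>x. f x - g x) T = fun_op f T - fun_op g T"
  using fun_op_add[OF assms(1,2), of "\<lambda>x. - 1 * g x"] fun_op_scale[OF assms(1,3), of "- 1"]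
  by (simp add: assms continuous_on_minus)

lemma fun_op_cong:
  assumes "selfadjoint T" "continuous_on (real_spectrum T) f"
    and "\<And>x. x \<in> real_spectrum T \<Longrightarrow> f x = g x"
  shows "fun_op f T = fun_op g T"
proof -
  have g: "continuous_on (real_spectrum T) g"
    using assms(2) continuous_on_cong[of "real_spectrum T" "real_spectrum T" f g] assms(3) by simp
  have "norm (fun_op (\<lambda>x. f x - g x) T) \<le> 0"
    using assms g by (intro norm_fun_op_le continuous_on_diff) auto
  then show ?thesis
    by (simp add: fun_op_minus assms(1,2) g)
qed

lemma fun_op_const:
  assumes "selfadjoint T"
  shows "fun_op (\<lambda>x. c) T = c *\<^sub>R id_blinfun"
proof -
  have "cfc T (\<lambda>z. 1) = id_blinfun"
    using continuous_functional_calculus_cfc[OF assms] by (simp add: continuous_functional_calculus_def)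
  then have "fun_op (\<lambda>x. 1) T = id_blinfun"
    using fun_op_eq[OF assms, of "\<lambda>_. 1"] by simp
  then show ?thesis
    using fun_op_scale[OF assms, of "\<lambda>_. 1" c] by simp
qed

lemma fun_op_id:
  assumes "selfadjoint T"
  shows "fun_op (\<lambda>x. x) T = T"
proof -
  have "cfc T (\<lambda>z. complex_of_real (Re z)) = cfc T (\<lambda>z. z)"
  proof (rule cfc_eqI[OF assms, where p = "\<lambda>_. [:0, 1:]"])
    show "uniform_limit (Sp T) (\<lambda>n. poly [:0, 1:]) (\<lambda>z. complex_of_real (Re z)) sequentially"
      by (rule uniform_limitI) (auto simp: Sp_eq_real_spectrum[OF assms])
    show "(\<lambda>n. poly_op [:0, 1:] T) \<longlonglongrightarrow> cfc T (\<lambda>z. z)"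
      by (intro poly_op_tendsto_cfc assms uniform_limitI) auto
  qed
  also have "\<dots> = T"
    using continuous_functional_calculus_cfc[OF assms] by (simp add: continuous_functional_calculus_def)
  finally show ?thesis
    using fun_op_eq[OF assms, of "\<lambda>x. x"] by simp
qed

lemma fun_op_tendsto:
  assumes T: "selfadjoint T" and "\<And>n. continuous_on (real_spectrum T) (h n)" "continuous_on (real_spectrum T) g"
    and lim: "uniform_limit (real_spectrum T) h g F"
  shows "((\<lambda>n. fun_op (h n) T) \<longlongrightarrow> fun_op g T) F"
proof -
  have "uniform_limit (Sp T) (\<lambda>n z. complex_of_real (h n (Re z))) (\<lambda>z. complex_of_real (g (Re z))) F"
    using lim by (intro bounded_linear_uniform_limit_intros uniform_limit_compose'[where h = Re])
      (auto simp: Sp_eq_real_spectrum[OF T])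
  then have "((\<lambda>n. cfc T (\<lambda>z. complex_of_real (h n (Re z))))
      \<longlongrightarrow> cfc T (\<lambda>z. complex_of_real (g (Re z)))) F"
    by (intro cfc_tendsto[OF T] continuous_on_Sp[OF T] assms(2,3))
  then show ?thesis
    using assms by (simp add: fun_op_eq)
qed

lemma fun_op_commute:
  assumes T: "selfadjoint T" and f: "continuous_on (real_spectrum T) f"
    and R: "R \<in> BH" "R o\<^sub>L T = T o\<^sub>L R"
  shows "R o\<^sub>L fun_op f T = fun_op f T o\<^sub>L R"
proof -
  obtain p where p: "uniform_limit (Sp T) (\<lambda>n. poly (p n)) (\<lambda>z. complex_of_real (f (Re z))) sequentially"
    using ex_poly_seq_Sp[OF T continuous_on_Sp[OF T f]] by blast
  have lim: "(\<lambda>n. poly_op (p n) T) \<longlonglongrightarrow> fun_op f T"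
    unfolding fun_op_eq[OF T f] by (rule poly_op_tendsto_cfc[OF T p])
  have "(\<lambda>n. R o\<^sub>L poly_op (p n) T) \<longlonglongrightarrow> (R o\<^sub>L fun_op f T)"
    by (intro blinfun_compose.tendsto lim tendsto_const)
  moreover have "(\<lambda>n. R o\<^sub>L poly_op (p n) T) \<longlonglongrightarrow> (fun_op f T o\<^sub>L R)"
    unfolding poly_op_commute[OF selfadjoint_BH[OF T] R]
    by (intro blinfun_compose.tendsto lim tendsto_const)
  ultimately show ?thesis
    by (rule LIMSEQ_unique)
qed

lemma fun_op_commute2:
  assumes "selfadjoint S" "continuous_on (real_spectrum S) f"
    and "selfadjoint T" "continuous_on (real_spectrum T) g" "S o\<^sub>L T = T o\<^sub>L S"
  shows "fun_op f S o\<^sub>L fun_op g T = fun_op g T o\<^sub>L fun_op f S"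
proof (rule fun_op_commute[OF assms(3,4)])
  show "fun_op f S o\<^sub>L T = T o\<^sub>L fun_op f S"
    using fun_op_commute[OF assms(1,2), of T] assms(3,5) by simp
qed (use fun_op_selfadjoint[OF assms(1,2)] in simp)

text \<open>If \<open>f\<close> omits the value \<open>l\<close> on the spectrum, then 1 / (f - l)
  is continuous there and yields an inverse of f(T) - l.\<close>

lemma real_spectrum_fun_op:
  assumes T: "selfadjoint T" and f: "continuous_on (real_spectrum T) f"
  shows "real_spectrum (fun_op f T) \<subseteq> f ` real_spectrum T"
proof
  fix l assume l: "l \<in> real_spectrum (fun_op f T)"
  show "l \<in> f ` real_spectrum T"
  proof (rule ccontr)
    assume *: "l \<notin> f ` real_spectrum T"
    have c1: "continuous_on (real_spectrum T) (\<lambda>x. f x - l)"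
      by (intro continuous_intros f)
    have c2: "continuous_on (real_spectrum T) (\<lambda>x. 1 / (f x - l))"
      using * by (intro continuous_intros f) auto
    have "fun_op (\<lambda>x. (f x - l) * (1 / (f x - l))) T = id_blinfun"
      "fun_op (\<lambda>x. 1 / (f x - l) * (f x - l)) T = id_blinfun"
      using fun_op_const[OF T, of 1] * T
      by (auto simp: intro!: continuous_on_const fun_op_cong[where f = "\<lambda>x. 1", symmetric, THEN trans])
    moreover have "fun_op (\<lambda>x. f x - l) T = fun_op f T - scaleC_op (complex_of_real l) id_blinfun"
      using fun_op_minus[OF T f, of "\<lambda>_. l"] fun_op_const[OF T, of l]
      by (simp add: scaleC_op_of_real)
    ultimately have "invertible_op (fun_op f T - scaleC_op (complex_of_real l) id_blinfun)"
      using fun_op_mult[OF T c1 c2] fun_op_mult[OF T c2 c1] fun_op_selfadjoint[OF T c2]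
      unfolding invertible_op_def by (metis selfadjoint_BH)
    with l show False
      by (simp add: real_spectrum_def Sp_def)
  qed
qed

text \<open>Polynomials that approximate \<open>g\<close> on the compact image of the spectrum under
  \<open>f\<close> serve both sides: the spectrum of f(T) lies in that image, and composed with
  \<open>f\<close> they approximate the composite on the spectrum of \<open>T\<close>. For
  polynomials the two sides agree by the homomorphism laws.\<close>

lemma fun_op_compose:
  assumes T: "selfadjoint T" and f: "continuous_on (real_spectrum T) f"
    and g: "continuous_on (f ` real_spectrum T) g"
  shows "fun_op g (fun_op f T) = fun_op (\<lambda>x. g (f x)) T"
proof -
  define S where "S = fun_op f T"
  have S: "selfadjoint S"
    unfolding S_def by (rule fun_op_selfadjoint[OF T f])
  have spS: "real_spectrum S \<subseteq> f ` real_spectrum T"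
    unfolding S_def by (rule real_spectrum_fun_op[OF T f])
  define K where "K = complex_of_real ` f ` real_spectrum T"
  have "compact K"
    unfolding K_def
    by (intro compact_continuous_image compact_real_spectrum[OF T] f continuous_intros)
  moreover have "continuous_on K (\<lambda>z. complex_of_real (g (Re z)))"
    unfolding K_def by (intro continuous_on_of_real continuous_on_compose2[OF g] continuous_intros) auto
  moreover have "Im z = 0" if "z \<in> K" for z
    using that by (auto simp: K_def)
  ultimately obtain p where p: "uniform_limit K (\<lambda>n. poly (p n)) (\<lambda>z. complex_of_real (g (Re z))) sequentially"
    using ex_poly_uniform_limit by blast
  have "Sp S \<subseteq> K"
    using spS unfolding Sp_eq_real_spectrum[OF S] K_def by blast
  then have "uniform_limit (Sp S) (\<lambda>n. poly (p n)) (\<lambda>z. complex_of_real (g (Re z))) sequentially"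
    by (rule uniform_limit_on_subset[OF p])
  then have "(\<lambda>n. poly_op (p n) S) \<longlonglongrightarrow> fun_op g S"
    using fun_op_eq[OF S continuous_on_subset[OF g spS]] poly_op_tendsto_cfc[OF S] by simp
  moreover have "poly_op q S = cfc T (\<lambda>z. poly q (complex_of_real (f (Re z))))" for q
  proof (induction q)
    case 0
    show ?case
      using cfc_poly[OF T, of 0] by (simp add: poly_0[abs_def])
  next
    case (pCons a q)
    have c: "continuous_on (Sp T) (\<lambda>z. complex_of_real (f (Re z)))"
      by (rule continuous_on_Sp[OF T f])
    have c': "continuous_on (Sp T) (\<lambda>z. poly q (complex_of_real (f (Re z))))"
      by (rule continuous_on_compose2[OF continuous_on_poly_complex c]) auto
    have const: "cfc T (\<lambda>z. a) = scaleC_op a id_blinfun"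
      using cfc_poly[OF T, of "[:a:]"] by (simp add: poly_pCons[abs_def] blinfun_compose.zero_right)
    show ?case
      using pCons fun_op_eq[OF T f] const cfc_mult[OF T c c']
        cfc_add[OF T continuous_on_const continuous_on_mult[OF c c'], of a]
      by (simp add: S_def)
  qed
  moreover have "(\<lambda>n. cfc T (\<lambda>z. poly (p n) (complex_of_real (f (Re z)))))
      \<longlonglongrightarrow> cfc T (\<lambda>z. complex_of_real (g (Re (complex_of_real (f (Re z))))))"
  proof (rule cfc_tendsto[OF T])
    show "uniform_limit (Sp T) (\<lambda>n z. poly (p n) (complex_of_real (f (Re z))))
        (\<lambda>z. complex_of_real (g (Re (complex_of_real (f (Re z)))))) sequentially"
      by (rule uniform_limit_compose'[OF p]) (auto simp: K_def Sp_eq_real_spectrum[OF T])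
    show "continuous_on (Sp T) (\<lambda>z. poly (p n) (complex_of_real (f (Re z))))" for n
      by (rule continuous_on_compose2[OF continuous_on_poly_complex continuous_on_Sp[OF T f]]) auto
    show "continuous_on (Sp T) (\<lambda>z. complex_of_real (g (Re (complex_of_real (f (Re z))))))"
      using continuous_on_Sp[OF T continuous_on_compose2[OF g f]] by simp
  qed
  ultimately show ?thesis
    using LIMSEQ_unique fun_op_eq[OF T continuous_on_compose2[OF g f]] by (simp add: S_def)
qed

text \<open>The operator is the square of a self-adjoint one, obtained from the root of
  \<open>f\<close>, so its quadratic form is a squared norm.\<close>

lemma positive_fun_op:
  assumes T: "selfadjoint T" and f: "continuous_on (real_spectrum T) f"
    and "\<And>x. x \<in> real_spectrum T \<Longrightarrow> 0 \<le> f x"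
  shows "positive_op (fun_op f T)"
proof -
  define Q where "Q = fun_op (\<lambda>x. sqrt (f x)) T"
  have c: "continuous_on (real_spectrum T) (\<lambda>x. sqrt (f x))"
    by (intro continuous_intros f)
  have "fun_op f T = fun_op (\<lambda>x. sqrt (f x) * sqrt (f x)) T"
    using assms by (intro fun_op_cong) auto
  then have eq: "fun_op f T = Q o\<^sub>L Q"
    by (simp only: fun_op_mult[OF T c c] Q_def)
  have Q: "selfadjoint Q"
    unfolding Q_def by (rule fun_op_selfadjoint[OF T c])
  have "0 \<le> Re (cinner (blinfun_apply (Q o\<^sub>L Q) x) x)" for x
    by (simp add: selfadjoint_cinner[OF Q] cinner_self del: of_real_power)
  then show ?thesis
    unfolding positive_op_iff using fun_op_selfadjoint[OF T f] eq by simp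
qed

text \<open>Translates a spectral bound into an operator inequality, which can be added and scaled;
  this later locates the spectrum of t K + (1 - t) L.\<close>

lemma real_spectrum_ge_iff:
  assumes T: "selfadjoint T"
  shows "real_spectrum T \<subseteq> {c..} \<longleftrightarrow> positive_op (T - c *\<^sub>R id_blinfun)"
proof
  assume "real_spectrum T \<subseteq> {c..}"
  then have "positive_op (fun_op (\<lambda>x. x - c) T)"
    by (intro positive_fun_op[OF T] continuous_intros) auto
  then show "positive_op (T - c *\<^sub>R id_blinfun)"
    using fun_op_minus[OF T, of "\<lambda>x. x" "\<lambda>_. c"] fun_op_const[OF T] fun_op_id[OF T] by simp
next
  assume "positive_op (T - c *\<^sub>R id_blinfun)"
  then have "c * (norm x)\<^sup>2 \<le> Re (cinner (blinfun_apply T x) x)" for x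
    by (auto simp: positive_op_iff op_apply cinner.diff_left cinner.scaleR_left cinner_self
        dest!: spec[of _ x] simp del: of_real_power)
  then show "real_spectrum T \<subseteq> {c..}"
    using Sp_lower[OF T] by (auto simp: real_spectrum_def)
qed

lemma real_spectrum_le_iff:
  assumes T: "selfadjoint T"
  shows "real_spectrum T \<subseteq> {..c} \<longleftrightarrow> positive_op (c *\<^sub>R id_blinfun - T)"
proof
  assume "real_spectrum T \<subseteq> {..c}"
  then have "positive_op (fun_op (\<lambda>x. c - x) T)"
    by (intro positive_fun_op[OF T] continuous_intros) auto
  then show "positive_op (c *\<^sub>R id_blinfun - T)"
    using fun_op_minus[OF T, of "\<lambda>_. c" "\<lambda>x. x"] fun_op_const[OF T] fun_op_id[OF T] by simp
next
  assume "positive_op (c *\<^sub>R id_blinfun - T)"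
  then have "Re (cinner (blinfun_apply T x) x) \<le> c * (norm x)\<^sup>2" for x
    by (auto simp: positive_op_iff op_apply cinner.diff_left cinner.scaleR_left cinner_self
        dest!: spec[of _ x] simp del: of_real_power)
  then show "real_spectrum T \<subseteq> {..c}"
    using Sp_upper[OF T] by (auto simp: real_spectrum_def)
qed

lemma real_spectrum_positive: "positive_op T \<Longrightarrow> real_spectrum T \<subseteq> {0..}"
  using real_spectrum_ge_iff[of T 0] positive_imp_selfadjoint[of T] by simp

text \<open>With R the square root of \<open>P\<close>, which commutes with \<open>Q\<close>, the
  form of P Q at x equals the form of \<open>Q\<close> at R x.\<close>

lemma positive_op_compose:
  assumes "positive_op P" "positive_op Q" and comm: "P o\<^sub>L Q = Q o\<^sub>L P"
  shows "positive_op (P o\<^sub>L Q)"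
proof -
  note P = positive_imp_selfadjoint[OF assms(1)] and Q = positive_imp_selfadjoint[OF assms(2)]
  have c: "continuous_on (real_spectrum P) sqrt"
    by (intro continuous_intros)
  define R where "R = fun_op sqrt P"
  have R: "selfadjoint R"
    unfolding R_def by (rule fun_op_selfadjoint[OF P c])
  have "fun_op (\<lambda>x. x) P = fun_op (\<lambda>x. sqrt x * sqrt x) P"
    using real_spectrum_positive[OF assms(1)] by (intro fun_op_cong[OF P] continuous_intros) auto
  then have RR: "P = R o\<^sub>L R"
    by (simp only: fun_op_mult[OF P c c] R_def fun_op_id[OF P])
  have "Q o\<^sub>L R = R o\<^sub>L Q"
    unfolding R_def using comm Q by (intro fun_op_commute[OF P c]) auto
  then have QR: "blinfun_apply R (blinfun_apply Q x) = blinfun_apply Q (blinfun_apply R x)" for x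
    by (metis blinfun_apply_blinfun_compose)
  have "0 \<le> Re (cinner (blinfun_apply (P o\<^sub>L Q) x) x)" for x
  proof -
    have "cinner (blinfun_apply (P o\<^sub>L Q) x) x
        = cinner (blinfun_apply R (blinfun_apply Q x)) (blinfun_apply R x)"
      unfolding RR by (simp add: selfadjoint_cinner[OF R])
    also have "\<dots> = cinner (blinfun_apply Q (blinfun_apply R x)) (blinfun_apply R x)"
      by (simp only: QR)
    finally show ?thesis
      using assms(2) by (simp add: positive_op_iff)
  qed
  then show ?thesis
    using selfadjoint_compose[OF P Q comm] by (simp add: positive_op_iff)
qed

section \<open>Exponentials of commuting operators\<close>

lemma fun_op_scaleR:
  assumes "selfadjoint K" "continuous_on ((*) c ` real_spectrum K) g"
  shows "fun_op g (c *\<^sub>R K) = fun_op (\<lambda>x. g (c * x)) K"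
proof -
  have "continuous_on (real_spectrum K) ((*) c)"
    by (intro continuous_intros)
  moreover have "fun_op ((*) c) K = c *\<^sub>R K"
    using fun_op_scale[OF assms(1), of "\<lambda>x. x" c] fun_op_id[OF assms(1)] by simp
  ultimately show ?thesis
    using fun_op_compose[OF assms(1), of "(*) c" g] assms(2) by simp
qed

lemma selfadjoint_exp [simp, intro]: "selfadjoint K \<Longrightarrow> selfadjoint (fun_op exp K)"
  by (intro fun_op_selfadjoint continuous_intros)

lemma fun_op_fun_op_exp:
  assumes "selfadjoint K" "continuous_on (exp ` real_spectrum K) g"
  shows "fun_op g (fun_op exp K) = fun_op (\<lambda>x. g (exp x)) K"
  using assms by (intro fun_op_compose continuous_intros)

lemma exp_scaleR: "selfadjoint K \<Longrightarrow> fun_op exp (c *\<^sub>R K) = fun_op (\<lambda>x. exp (c * x)) K"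
  by (intro fun_op_scaleR continuous_intros)

lemma ln_exp_op: "selfadjoint K \<Longrightarrow> fun_op ln (fun_op exp K) = K"
  by (subst fun_op_fun_op_exp) (auto intro!: continuous_intros simp: fun_op_id)

lemma powr_exp_op: "selfadjoint K \<Longrightarrow> fun_op exp K powr\<^sub>o\<^sub>p t = fun_op exp (t *\<^sub>R K)"
  by (subst fun_op_fun_op_exp) (auto intro!: continuous_intros, simp add: exp_scaleR powr_def)

lemma sqrt_exp_op: "selfadjoint K \<Longrightarrow> fun_op sqrt (fun_op exp K) = fun_op exp ((1/2) *\<^sub>R K)"
proof (subst fun_op_fun_op_exp)
  have "sqrt (exp x) = exp (1 / 2 * x)" for x :: real
    by (rule real_sqrt_unique) (simp_all flip: exp_double add: power2_eq_square exp_add[symmetric])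
  then show "selfadjoint K \<Longrightarrow> fun_op (\<lambda>x. sqrt (exp x)) K = fun_op exp ((1/2) *\<^sub>R K)"
    by (simp add: exp_scaleR)
qed (auto intro!: continuous_intros)

lemma exp_ln_op:
  assumes "selfadjoint X" "real_spectrum X \<subseteq> {0<..}"
  shows "fun_op exp (fun_op ln X) = X"
proof -
  have c: "continuous_on (real_spectrum X) ln"
    using assms(2) by (intro continuous_intros) auto
  have "fun_op exp (fun_op ln X) = fun_op (\<lambda>x. exp (ln x)) X"
    by (rule fun_op_compose[OF assms(1) c]) (intro continuous_intros)
  also have "\<dots> = fun_op (\<lambda>x. x) X"
    using assms c by (intro fun_op_cong continuous_intros) auto
  finally show ?thesis
    using fun_op_id[OF assms(1)] by simp
qed

lemma positive_exp: "selfadjoint K \<Longrightarrow> positive_op (fun_op exp K)"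
  by (intro positive_fun_op continuous_intros) auto

lemma exp_uminus_op:
  assumes "selfadjoint K"
  shows "fun_op exp K o\<^sub>L fun_op exp (- K) = id_blinfun"
    and "fun_op exp (- K) o\<^sub>L fun_op exp K = id_blinfun"
proof -
  have "fun_op exp (- K) = fun_op (\<lambda>x. exp (- x)) K"
    using exp_scaleR[OF assms, of "- 1"] by simp
  moreover have c: "continuous_on (real_spectrum K) exp" "continuous_on (real_spectrum K) (\<lambda>x. exp (- x))"
    by (intro continuous_intros)+
  ultimately show "fun_op exp K o\<^sub>L fun_op exp (- K) = id_blinfun"
    and "fun_op exp (- K) o\<^sub>L fun_op exp K = id_blinfun"
    using fun_op_mult[OF assms c] fun_op_mult[OF assms c(2,1)] fun_op_const[OF assms, of 1]
    by (simp_all flip: exp_add)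
qed

lemma selfadjoint_uminus [simp, intro]: "selfadjoint K \<Longrightarrow> selfadjoint (- K)"
  using selfadjoint_intros(5)[of K "- 1"] by simp

lemma real_spectrum_pos:
  assumes "positive_op Z" "invertible_op Z"
  shows "real_spectrum Z \<subseteq> {0<..}"
proof -
  have "0 \<notin> real_spectrum Z"
    using assms(2) by (simp add: real_spectrum_def Sp_def)
  then show ?thesis
    using real_spectrum_positive[OF assms(1)] by (force simp: less_le)
qed

lemma exp_half_op:
  assumes "selfadjoint K"
  shows "fun_op exp ((1/2) *\<^sub>R K) o\<^sub>L fun_op exp ((1/2) *\<^sub>R K) = fun_op exp K"
proof -
  have "continuous_on (real_spectrum K) (\<lambda>x. exp (1 / 2 * x))"
    by (intro continuous_intros)
  then show ?thesis
    using fun_op_mult[OF assms, of "\<lambda>x. exp (1 / 2 * x)" "\<lambda>x. exp (1 / 2 * x)"]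
    by (simp add: exp_scaleR[OF assms] flip: exp_add)
qed

text \<open>Controls the difference quotient of exp at 0: with y = x / 2^k the error of 2^k (exp y -
  1) against x is at most x^2 / 2^k.\<close>

lemma abs_exp_minus_one_le:
  fixes y :: real
  assumes "\<bar>y\<bar> \<le> 1"
  shows "\<bar>exp y - 1 - y\<bar> \<le> y\<^sup>2"
proof -
  have "exp y \<le> 1 + y + y\<^sup>2"
  proof (cases "y \<ge> 0")
    case True
    then show ?thesis using assms exp_bound[of y] by simp
  next
    case False
    have "1 - y \<le> exp (- y)"
      using exp_ge_add_one_self[of "- y"] by simp
    then have "exp y \<le> 1 / (1 - y)"
      using False by (simp add: exp_minus field_simps)
    also have "\<dots> \<le> 1 + y + y\<^sup>2"
    proof -
      \<comment> \<open>For negative \<open>y\<close> the right-hand side exceeds 1, so 1 / (1 - y)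
        lies below the quadratic.\<close>
      have "(1 + y + y\<^sup>2) * (1 - y) = 1 + (- y) ^ 3"
        by (simp add: power2_eq_square power3_eq_cube algebra_simps)
      then show ?thesis
        using False by (simp add: divide_le_eq)
    qed
    finally show ?thesis .
  qed
  then show ?thesis
    using exp_ge_add_one_self[of y] zero_le_power2[of y] by linarith
qed

text \<open>The derivative of exp (c K) at c = 0, taken along c = 1/2^k because these are the
  exponents reached by repeated square roots. The spectrum is bounded, so the scalar limit is
  uniform on it.\<close>

lemma exp_generator_tendsto:
  assumes K: "selfadjoint K"
  shows "(\<lambda>k. 2 ^ k *\<^sub>R (fun_op exp ((1 / 2 ^ k) *\<^sub>R K) - id_blinfun)) \<longlonglongrightarrow> K"
proof -
  define M where "M = norm K"
  have M: "\<bar>x\<bar> \<le> M" if "x \<in> real_spectrum K" for x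
    using Sp_norm_le[OF K, of "complex_of_real x"] that by (simp add: real_spectrum_def M_def)
  have "uniform_limit (real_spectrum K) (\<lambda>k x. 2 ^ k * (exp (1 / 2 ^ k * x) - 1)) (\<lambda>x. x) sequentially"
  proof (rule metric_uniform_limit_imp_uniform_limit)
    have "(\<lambda>k. M\<^sup>2 * (1 / 2) ^ k) \<longlonglongrightarrow> M\<^sup>2 * 0"
      by (intro tendsto_intros LIMSEQ_power_zero) simp
    then show "uniform_limit (real_spectrum K) (\<lambda>k x. M\<^sup>2 * (1 / 2) ^ k) (\<lambda>x. 0) sequentially"
      by (auto intro!: uniform_limitI dest!: tendstoD)
    have "(\<lambda>k. M * (1 / 2) ^ k) \<longlonglongrightarrow> M * 0"
      by (intro tendsto_intros LIMSEQ_power_zero) simp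
    then have "\<forall>\<^sub>F k in sequentially. M * (1 / 2) ^ k < 1"
      by (intro order_tendstoD(2)[where y = "M * 0"]) simp_all
    then show "\<forall>\<^sub>F k in sequentially. \<forall>x\<in>real_spectrum K.
        dist (2 ^ k * (exp (1 / 2 ^ k * x) - 1)) x \<le> dist (M\<^sup>2 * (1 / 2) ^ k) 0"
    proof eventually_elim
      case (elim k)
      show ?case
      proof
        fix x assume x: "x \<in> real_spectrum K"
        define y where "y = 1 / 2 ^ k * x"
        have "\<bar>y\<bar> = \<bar>x\<bar> * (1 / 2) ^ k"
          by (simp add: y_def abs_mult power_one_over)
        also have "\<dots> \<le> M * (1 / 2) ^ k"
          by (intro mult_right_mono M[OF x]) simp
        finally have "\<bar>y\<bar> \<le> 1"
          using elim by linarith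
        then have "2 ^ k * \<bar>exp y - 1 - y\<bar> \<le> 2 ^ k * y\<^sup>2"
          by (intro mult_left_mono abs_exp_minus_one_le) auto
        also have "\<dots> = x\<^sup>2 * (1 / 2) ^ k"
          by (simp add: y_def power2_eq_square power_one_over field_simps)
        also have "\<dots> \<le> M\<^sup>2 * (1 / 2) ^ k"
          using power_mono[OF M[OF x], of 2] by (intro mult_right_mono) auto
        also have "2 ^ k * \<bar>exp y - 1 - y\<bar> = \<bar>2 ^ k * (exp y - 1 - y)\<bar>"
          by (simp add: abs_mult)
        also have "2 ^ k * (exp y - 1 - y) = 2 ^ k * (exp y - 1) - x"
          by (simp add: y_def right_diff_distrib)
        finally show "dist (2 ^ k * (exp (1 / 2 ^ k * x) - 1)) x \<le> dist (M\<^sup>2 * (1 / 2) ^ k) 0"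
          by (simp add: y_def dist_real_def)
      qed
    qed
  qed
  then have "(\<lambda>k. fun_op (\<lambda>x. 2 ^ k * (exp (1 / 2 ^ k * x) - 1)) K) \<longlonglongrightarrow> fun_op (\<lambda>x. x) K"
    by (intro fun_op_tendsto[OF K] continuous_intros)
  moreover have "fun_op (\<lambda>x. 2 ^ k * (exp (1 / 2 ^ k * x) - 1)) K
      = 2 ^ k *\<^sub>R (fun_op exp ((1 / 2 ^ k) *\<^sub>R K) - id_blinfun)" for k
  proof -
    have c: "continuous_on (real_spectrum K) (\<lambda>x. exp (1 / 2 ^ k * x))"
      by (intro continuous_intros)
    have "fun_op (\<lambda>x. exp (1 / 2 ^ k * x) - 1) K = fun_op exp ((1 / 2 ^ k) *\<^sub>R K) - id_blinfun"
      using fun_op_minus[OF K c continuous_on_const, of 1] fun_op_const[OF K, of 1] exp_scaleR[OF K, of "1 / 2 ^ k"] by simp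
    then show ?thesis
      using fun_op_scale[OF K, of "\<lambda>x. exp (1 / 2 ^ k * x) - 1" "2 ^ k"] c
      by (simp add: continuous_on_diff)
  qed
  ultimately show ?thesis
    using fun_op_id[OF K] by simp
qed

text \<open>With \<open>W = ln (exp K exp L)\<close> and \<open>R k = exp (K / 2^k) exp (L / 2^k)\<close>, uniqueness of positive square roots
  gives \<open>R k = exp (W / 2^k)\<close>, and \<open>2^k (R k - 1)\<close> tends to \<open>W\<close> as well as to \<open>K + L\<close>.\<close>
lemma exp_add_op:
  assumes K: "selfadjoint K" and L: "selfadjoint L" and comm: "K o\<^sub>L L = L o\<^sub>L K"
  shows "fun_op exp (K + L) = fun_op exp K o\<^sub>L fun_op exp L"
proof -
  have commE: "fun_op exp (c *\<^sub>R K) o\<^sub>L fun_op exp (d *\<^sub>R L) = fun_op exp (d *\<^sub>R L) o\<^sub>L fun_op exp (c *\<^sub>R K)" for c d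
    using K L comm
    by (intro fun_op_commute2 continuous_intros)
       (auto simp: blinfun_compose.scaleR_left blinfun_compose.scaleR_right)
  define R where "R k = fun_op exp ((1 / 2 ^ k) *\<^sub>R K) o\<^sub>L fun_op exp ((1 / 2 ^ k) *\<^sub>R L)" for k :: nat
  have Rpos: "positive_op (R k)" for k
    unfolding R_def using K L commE by (intro positive_op_compose positive_exp) auto
  have Rsq: "R k = R (Suc k) o\<^sub>L R (Suc k)" for k
  proof -
    define P where "P = fun_op exp ((1 / 2 ^ Suc k) *\<^sub>R K)"
    define Q where "Q = fun_op exp ((1 / 2 ^ Suc k) *\<^sub>R L)"
    have "P o\<^sub>L P = fun_op exp ((1 / 2 ^ k) *\<^sub>R K)" "Q o\<^sub>L Q = fun_op exp ((1 / 2 ^ k) *\<^sub>R L)"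
      using exp_half_op[of "(1 / 2 ^ k) *\<^sub>R K"] exp_half_op[of "(1 / 2 ^ k) *\<^sub>R L"] K L
      by (simp_all add: P_def Q_def)
    moreover have "P o\<^sub>L Q = Q o\<^sub>L P"
      unfolding P_def Q_def by (rule commE)
    then have "blinfun_apply P (blinfun_apply Q x) = blinfun_apply Q (blinfun_apply P x)" for x
      by (metis blinfun_apply_blinfun_compose)
    then have "(P o\<^sub>L P) o\<^sub>L (Q o\<^sub>L Q) = (P o\<^sub>L Q) o\<^sub>L (P o\<^sub>L Q)"
      by (intro blinfun_eqI) simp
    ultimately show ?thesis
      unfolding R_def P_def Q_def by metis
  qed
  \<comment> \<open>Invertibility keeps 0 out of the spectrum of \<open>R 0\<close>, so that ln is
    continuous there and \<open>W\<close> can be formed.\<close>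
  have "invertible_op (fun_op exp K)" "invertible_op (fun_op exp L)"
    using exp_uminus_op K L unfolding invertible_op_def
    by (metis selfadjoint_BH selfadjoint_exp selfadjoint_uminus)+
  then have "invertible_op (R 0)"
    by (simp add: R_def invertible_op_compose)
  then have spec: "real_spectrum (R 0) \<subseteq> {0<..}"
    by (rule real_spectrum_pos[OF Rpos])
  define W where "W = fun_op ln (R 0)"
  have R0: "selfadjoint (R 0)"
    by (rule positive_imp_selfadjoint[OF Rpos])
  have W: "selfadjoint W"
    unfolding W_def using spec by (intro fun_op_selfadjoint[OF R0] continuous_intros) auto
  have RW: "R k = fun_op exp ((1 / 2 ^ k) *\<^sub>R W)" for k
  proof (induction k)
    case 0
    show ?case
      using exp_ln_op[OF R0 spec] by (simp add: W_def)
  next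
    case (Suc k)
    let ?R = "R (Suc k)"
    have sa: "selfadjoint ?R"
      by (rule positive_imp_selfadjoint[OF Rpos])
    have sq: "fun_op (\<lambda>x. x * x) ?R = R k"
      using fun_op_mult[OF sa, of "\<lambda>x. x" "\<lambda>x. x"] fun_op_id[OF sa] Rsq[of k] by simp
    \<comment> \<open>Uniqueness of the positive root, expressed in the calculus: sqrt (x * x) = x
      on the nonnegative spectrum of \<open>?R\<close>, and the square of \<open>?R\<close> is
      \<open>R k\<close>.\<close>
    have "?R = fun_op (\<lambda>x. x) ?R"
      using fun_op_id[OF sa] by simp
    also have "\<dots> = fun_op (\<lambda>x. sqrt (x * x)) ?R"
      using real_spectrum_positive[OF Rpos, of "Suc k"]
      by (intro fun_op_cong[OF sa] continuous_intros) auto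
    also have "\<dots> = fun_op sqrt (R k)"
      unfolding sq[symmetric] by (intro fun_op_compose[OF sa, symmetric] continuous_intros)
    also have "\<dots> = fun_op exp ((1/2) *\<^sub>R ((1 / 2 ^ k) *\<^sub>R W))"
      unfolding Suc using W by (intro sqrt_exp_op) auto
    finally show ?case by simp
  qed
  define P where "P k = fun_op exp ((1 / 2 ^ k) *\<^sub>R K)" for k :: nat
  define Q where "Q k = fun_op exp ((1 / 2 ^ k) *\<^sub>R L)" for k :: nat
  have limP: "(\<lambda>k. 2 ^ k *\<^sub>R (P k - id_blinfun)) \<longlonglongrightarrow> K"
    unfolding P_def by (rule exp_generator_tendsto[OF K])
  have limQ: "(\<lambda>k. 2 ^ k *\<^sub>R (Q k - id_blinfun)) \<longlonglongrightarrow> L"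
    unfolding Q_def by (rule exp_generator_tendsto[OF L])
  have "(\<lambda>k. (1/2) ^ k *\<^sub>R (2 ^ k *\<^sub>R (Q k - id_blinfun)) + id_blinfun) \<longlonglongrightarrow> 0 *\<^sub>R L + id_blinfun"
    by (intro tendsto_intros limQ LIMSEQ_power_zero) simp
  then have limQ': "Q \<longlonglongrightarrow> id_blinfun"
    by (simp add: power_one_over)
  \<comment> \<open>The splitting P Q - 1 = (P - 1) Q + (Q - 1), scaled by 2^k, turns the product
    into a sum of generators, since Q tends to the identity.\<close>
  have "(\<lambda>k. (2 ^ k *\<^sub>R (P k - id_blinfun) o\<^sub>L Q k) + 2 ^ k *\<^sub>R (Q k - id_blinfun))
      \<longlonglongrightarrow> (K o\<^sub>L id_blinfun) + L"
    by (intro tendsto_add blinfun_compose.tendsto limP limQ limQ')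
  moreover have "(2 ^ k *\<^sub>R (P k - id_blinfun) o\<^sub>L Q k) + 2 ^ k *\<^sub>R (Q k - id_blinfun)
      = 2 ^ k *\<^sub>R (R k - id_blinfun)" for k
    by (intro blinfun_eqI) (simp add: R_def P_def Q_def op_apply algebra_simps)
  moreover have "K o\<^sub>L id_blinfun = K"
    by (intro blinfun_eqI) simp
  ultimately have "(\<lambda>k. 2 ^ k *\<^sub>R (R k - id_blinfun)) \<longlonglongrightarrow> K + L"
    by simp
  moreover have "(\<lambda>k. 2 ^ k *\<^sub>R (R k - id_blinfun)) \<longlonglongrightarrow> W"
    unfolding RW by (rule exp_generator_tendsto[OF W])
  ultimately have "W = K + L"
    using LIMSEQ_unique by blast
  then show ?thesis
    using RW[of 0] by (simp add: R_def)
qed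

text \<open>Multiplying by exp (-X), which is positive and commutes with both exponentials, gives
  exp (Y - X) \<ge> 1. The spectrum of that operator lies in the half-line from 1 on, where ln is
  nonnegative.\<close>

lemma exp_le_op_imp_le_op:
  assumes X: "selfadjoint X" and Y: "selfadjoint Y" and comm: "X o\<^sub>L Y = Y o\<^sub>L X"
    and le: "fun_op exp X \<le>\<^sub>o\<^sub>p fun_op exp Y"
  shows "X \<le>\<^sub>o\<^sub>p Y"
proof -
  define D where "D = Y - X"
  have D: "selfadjoint D"
    using X Y by (auto simp: D_def)
  have commE: "fun_op exp (- X) o\<^sub>L fun_op exp Z = fun_op exp Z o\<^sub>L fun_op exp (- X)"
    if "selfadjoint Z" "X o\<^sub>L Z = Z o\<^sub>L X" for Z
    using X that
    by (intro fun_op_commute2 continuous_intros)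
       (auto simp: blinfun_compose.minus_left blinfun_compose.minus_right)
  have "fun_op exp (- X + Y) = fun_op exp (- X) o\<^sub>L fun_op exp Y"
    using X Y comm
    by (intro exp_add_op) (auto simp: blinfun_compose.minus_left blinfun_compose.minus_right)
  then have "fun_op exp D - 1 *\<^sub>R id_blinfun = fun_op exp (- X) o\<^sub>L (fun_op exp Y - fun_op exp X)"
    by (simp add: D_def blinfun_compose.diff_right exp_uminus_op(2)[OF X])
  also have "positive_op \<dots>"
    using X le commE[OF Y comm] commE[OF X]
    by (intro positive_op_compose positive_exp)
       (auto simp: le_op_def blinfun_compose.diff_left blinfun_compose.diff_right)
  finally have spec: "real_spectrum (fun_op exp D) \<subseteq> {1..}"
    using D by (subst real_spectrum_ge_iff) auto
  have "positive_op (fun_op ln (fun_op exp D))"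
    using D spec by (intro positive_fun_op continuous_intros) (auto simp: subset_iff)
  then show ?thesis
    by (simp add: ln_exp_op[OF D] le_op_def) (simp add: D_def)
qed

section \<open>Norm continuity and integration of operator-valued functions\<close>

lemma norm_poly_op_minus_fun_op_le:
  assumes T: "selfadjoint T" and h: "continuous_on (real_spectrum T) h" and "e \<ge> 0"
    and "\<And>z. z \<in> Sp T \<Longrightarrow> cmod (poly p z - complex_of_real (h (Re z))) \<le> e"
  shows "norm (poly_op p T - fun_op h T) \<le> e"
proof -
  have c: "continuous_on (Sp T) (\<lambda>z. poly p z - complex_of_real (h (Re z)))"
    by (intro continuous_on_diff continuous_on_poly_complex continuous_on_Sp[OF T h])
  have "cfc T (\<lambda>z. (poly p z - complex_of_real (h (Re z))) + complex_of_real (h (Re z)))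
      = cfc T (\<lambda>z. poly p z - complex_of_real (h (Re z))) + fun_op h T"
    unfolding fun_op_eq[OF T h] by (rule cfc_add[OF T c continuous_on_Sp[OF T h]])
  then have "poly_op p T - fun_op h T = cfc T (\<lambda>z. poly p z - complex_of_real (h (Re z)))"
    using cfc_poly[OF T, of p] by simp
  with norm_cfc_le[OF T c assms(3,4)] show ?thesis
    by simp
qed

text \<open>Polynomials in X t are continuous in t. A single compact set containing all the spectra
  makes the polynomial approximation uniform in t, so continuity passes to the limit.\<close>

lemma continuous_on_fun_op:
  assumes sa: "\<And>t. t \<in> S \<Longrightarrow> selfadjoint (X t)" and X: "continuous_on S X"
    and sp: "\<And>t. t \<in> S \<Longrightarrow> real_spectrum (X t) \<subseteq> K"
    and "compact K" and h: "continuous_on K h"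
  shows "continuous_on S (\<lambda>t. fun_op h (X t))"
proof -
  have "compact (complex_of_real ` K)"
    by (intro compact_continuous_image \<open>compact K\<close> continuous_intros)
  moreover have "continuous_on (complex_of_real ` K) (\<lambda>z. complex_of_real (h (Re z)))"
    by (intro continuous_on_of_real continuous_on_compose2[OF h] continuous_intros) auto
  moreover have "Im z = 0" if "z \<in> complex_of_real ` K" for z
    using that by auto
  ultimately obtain p where
    p: "uniform_limit (complex_of_real ` K) (\<lambda>n. poly (p n)) (\<lambda>z. complex_of_real (h (Re z))) sequentially"
    using ex_poly_uniform_limit by blast
  have cont: "continuous_on S (\<lambda>t. poly_op q (X t))" for q
    by (induction q) (auto intro!: continuous_on_add continuous_on_const blinfun_compose.continuous_on X)
  have "uniform_limit S (\<lambda>n t. poly_op (p n) (X t)) (\<lambda>t. fun_op h (X t)) sequentially"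
  proof (rule uniform_limitI)
    fix e :: real assume "e > 0"
    then have "\<forall>\<^sub>F n in sequentially. \<forall>z\<in>complex_of_real ` K.
        dist (poly (p n) z) (complex_of_real (h (Re z))) < e / 2"
      using uniform_limitD[OF p, of "e / 2"] by simp
    then show "\<forall>\<^sub>F n in sequentially. \<forall>t\<in>S. dist (poly_op (p n) (X t)) (fun_op h (X t)) < e"
    proof eventually_elim
      case (elim n)
      show ?case
      proof
        fix t assume t: "t \<in> S"
        have "norm (poly_op (p n) (X t) - fun_op h (X t)) \<le> e / 2"
        proof (rule norm_poly_op_minus_fun_op_le[OF sa[OF t] continuous_on_subset[OF h sp[OF t]]])
          fix z assume "z \<in> Sp (X t)"
          then have "z \<in> complex_of_real ` K"
            using sp[OF t] unfolding Sp_eq_real_spectrum[OF sa[OF t]] by blast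
          then show "cmod (poly (p n) z - complex_of_real (h (Re z))) \<le> e / 2"
            using elim by (auto simp: dist_norm intro: less_imp_le)
        qed (use \<open>e > 0\<close> in simp)
        then show "dist (poly_op (p n) (X t)) (fun_op h (X t)) < e"
          using \<open>e > 0\<close> by (simp add: dist_norm)
      qed
    qed
  qed
  then show ?thesis
    by (rule uniform_limit_theorem[rotated]) (auto intro!: always_eventually cont)
qed

lemma positive_op_intros [intro]:
  "positive_op 0"
  "positive_op S \<Longrightarrow> positive_op T \<Longrightarrow> positive_op (S + T)"
  "r \<ge> 0 \<Longrightarrow> positive_op T \<Longrightarrow> positive_op (r *\<^sub>R T)"
  by (simp_all add: positive_op_iff op_apply cinner.zero_left cinner.add_left cinner.scaleR_left)

text \<open>Bounded linear maps pass under the integral. The integral is formed among real-linear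
  operators, so complex linearity is part of the claim; it is tested with the map T to T (c x) - c T
  x.\<close>

lemma positive_op_integral:
  assumes int: "F integrable_on {a..b::real}" and pos: "\<And>t. t \<in> {a..b} \<Longrightarrow> positive_op (F t)"
  shows "positive_op (integral {a..b} F)"
proof -
  have "blinfun_apply (integral {a..b} F) (c *\<^sub>C x) - c *\<^sub>C blinfun_apply (integral {a..b} F) x = 0" for c x
  proof -
    define G where "G T = blinfun_apply T (c *\<^sub>C x) - c *\<^sub>C blinfun_apply T x" for T :: "'a \<Rightarrow>\<^sub>L 'a"
    have "bounded_linear G"
      unfolding G_def
      by (intro bounded_linear_sub bounded_linear_compose[OF bounded_linear_scaleC] bounded_linear_apply_blinfun)
    then have "G (integral {a..b} F) = integral {a..b} (G \<circ> F)"
      by (rule integral_linear[OF int, symmetric])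
    also have "\<dots> = integral {a..b} (\<lambda>_. 0)"
      using pos by (intro integral_cong) (auto simp: G_def positive_op_def BH_apply)
    finally show ?thesis by (simp add: G_def)
  qed
  then have "integral {a..b} F \<in> BH"
    by (simp add: BH_def)
  moreover have "cinner (blinfun_apply (integral {a..b} F) x) x \<in> \<real>\<^sub>\<ge>\<^sub>0" for x
  proof -
    define G where "G T = cinner (blinfun_apply T x) x" for T :: "'a \<Rightarrow>\<^sub>L 'a"
    have bl: "bounded_linear G"
      unfolding G_def
      by (rule bounded_linear_compose[OF cinner.bounded_linear_left bounded_linear_apply_blinfun])
    have "Re (G (integral {a..b} F)) = integral {a..b} ((\<lambda>T. Re (G T)) \<circ> F)"
      using integral_linear[OF int bounded_linear_compose[OF bounded_linear_Re bl]] by simp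
    also have "\<dots> \<ge> 0"
      using integrable_linear[OF int bounded_linear_compose[OF bounded_linear_Re bl]] pos
      by (intro integral_nonneg) (auto simp: G_def positive_op_iff)
    finally have "Re (G (integral {a..b} F)) \<ge> 0" .
    moreover have "Im (G (integral {a..b} F)) = integral {a..b} ((\<lambda>T. Im (G T)) \<circ> F)"
      using integral_linear[OF int bounded_linear_compose[OF bounded_linear_Im bl]] by simp
    moreover have "\<dots> = integral {a..b} (\<lambda>_. 0)"
      using pos by (intro integral_cong) (auto simp: G_def positive_op_iff)
    ultimately show ?thesis
      by (simp add: G_def complex_nonneg_Reals_iff)
  qed
  ultimately show ?thesis
    by (simp add: positive_op_def)
qed

section \<open>The operator Hermite-Hadamard inequality\<close>

lemma poly_op_in_algebra:
  assumes "commutative_cstar_algebra \<A>" "id_blinfun \<in> \<A>" "T \<in> \<A>"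
  shows "poly_op p T \<in> \<A>"
proof (induction p)
  case 0
  show ?case using assms(1) by (simp add: commutative_cstar_algebra_def)
next
  case (pCons a p)
  then show ?case
    using assms unfolding commutative_cstar_algebra_def by simp
qed

lemma fun_op_in_algebra:
  assumes "commutative_cstar_algebra \<A>" "id_blinfun \<in> \<A>" "T \<in> \<A>"
    and T: "selfadjoint T" and f: "continuous_on (real_spectrum T) f"
  shows "fun_op f T \<in> \<A>"
proof -
  obtain p where p: "uniform_limit (Sp T) (\<lambda>n. poly (p n)) (\<lambda>z. complex_of_real (f (Re z))) sequentially"
    using ex_poly_seq_Sp[OF T continuous_on_Sp[OF T f]] by blast
  have "closed \<A>"
    using assms(1) by (simp add: commutative_cstar_algebra_def)
  then show ?thesis
    using poly_op_tendsto_cfc[OF T p] poly_op_in_algebra[OF assms(1-3)] fun_op_eq[OF T f]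
    by (metis closed_sequentially)
qed

lemma real_spectrum_strictly_positive:
  assumes "T \<in> strictly_positive \<A>"
  shows "selfadjoint T" "real_spectrum T \<subseteq> {0<..}"
  using assms real_spectrum_pos[of T] positive_imp_selfadjoint[of T]
  by (auto simp: strictly_positive_def)

lemma exp_op_strictly_positive:
  assumes "selfadjoint K" "fun_op exp K \<in> \<A>"
  shows "fun_op exp K \<in> strictly_positive \<A>"
proof -
  have "invertible_op (fun_op exp K)"
    using exp_uminus_op[OF assms(1)] assms(1) unfolding invertible_op_def
    by (metis selfadjoint_BH selfadjoint_exp selfadjoint_uminus)
  then show ?thesis
    using assms positive_exp by (simp add: strictly_positive_def)
qed

text \<open>The identity is a limit of polynomials in \<open>T\<close> without constant term, since the function 1 is one of
  multiples of \<open>z\<close> on the spectrum, which avoids 0.\<close>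
lemma id_in_algebra:
  assumes alg: "commutative_cstar_algebra \<A>" and "T \<in> strictly_positive \<A>"
  shows "id_blinfun \<in> \<A>"
proof -
  note T = real_spectrum_strictly_positive[OF assms(2)]
  have c: "continuous_on (Sp T) (\<lambda>z. 1 / z)"
    using T by (intro continuous_intros) (auto simp: Sp_eq_real_spectrum)
  then obtain p where p: "uniform_limit (Sp T) (\<lambda>n. poly (p n)) (\<lambda>z. 1 / z) sequentially"
    using ex_poly_seq_Sp[OF T(1)] by blast
  have "T \<in> \<A>"
    using assms(2) by (simp add: strictly_positive_def)
  have mem: "T o\<^sub>L poly_op q T \<in> \<A>" for q
  proof (induction q)
    case 0
    show ?case
      using alg by (simp add: commutative_cstar_algebra_def blinfun_compose.zero_right)
  next
    case (pCons a q)
    have "T o\<^sub>L scaleC_op a id_blinfun = scaleC_op a T"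
      using T(1) by (intro blinfun_eqI) (simp add: BH_apply)
    then show ?case
      using alg \<open>T \<in> \<A>\<close> pCons
      by (simp add: commutative_cstar_algebra_def blinfun_compose.add_right)
  qed
  have "(\<lambda>n. T o\<^sub>L poly_op (p n) T) \<longlonglongrightarrow> (T o\<^sub>L cfc T (\<lambda>z. 1 / z))"
    by (intro blinfun_compose.tendsto tendsto_const poly_op_tendsto_cfc[OF T(1) p])
  moreover have "T o\<^sub>L cfc T (\<lambda>z. 1 / z) = id_blinfun"
  proof -
    have T_eq: "cfc T (\<lambda>z. z) = T" and one: "cfc T (\<lambda>z. 1) = id_blinfun"
      using continuous_functional_calculus_cfc[OF T(1)] by (simp_all add: continuous_functional_calculus_def)
    \<comment> \<open>z * (1 / z) agrees with 1 on the spectrum but not at 0, so the two values of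
      the calculus are compared through one sequence that approximates both functions.\<close>
    obtain q where q: "uniform_limit (Sp T) (\<lambda>n. poly (q n)) (\<lambda>z. 1 :: complex) sequentially"
      using ex_poly_seq_Sp[OF T(1) continuous_on_const] by blast
    then have "uniform_limit (Sp T) (\<lambda>n. poly (q n)) (\<lambda>z. z * (1 / z)) sequentially"
      using T by (subst uniform_limit_cong'[where g = "\<lambda>n. poly (q n)" and i = "\<lambda>z. 1"])
        (auto simp: Sp_eq_real_spectrum)
    then have "cfc T (\<lambda>z. z * (1 / z)) = cfc T (\<lambda>z. 1)"
      by (rule cfc_eqI[OF T(1) _ poly_op_tendsto_cfc[OF T(1) q]])
    with cfc_mult[OF T(1) continuous_on_id c] show ?thesis
      by (simp add: T_eq one)
  qed
  moreover have "closed \<A>"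
    using alg by (simp add: commutative_cstar_algebra_def)
  ultimately show ?thesis
    using mem closed_sequentially by metis
qed

text \<open>The scalar argument in the operator order: the lower bound integrates F (1/2) \<le> (F t
  + F (1 - t)) / 2, with the reflection of t preserving the integral, and the upper bound integrates
  F t \<le> t F 1 + (1 - t) F 0.\<close>

lemma hermite_hadamard_op:
  fixes F :: "real \<Rightarrow> ('a::complex_hilbert \<Rightarrow>\<^sub>L 'a)"
  assumes cont: "continuous_on {0..1} F"
    and conv: "\<And>l s t. l \<in> {0..1} \<Longrightarrow> s \<in> {0..1} \<Longrightarrow> t \<in> {0..1} \<Longrightarrow>
      F (l * s + (1 - l) * t) \<le>\<^sub>o\<^sub>p l *\<^sub>R F s + (1 - l) *\<^sub>R F t"
  shows "F (1/2) \<le>\<^sub>o\<^sub>p integral {0..1} F"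
    and "integral {0..1} F \<le>\<^sub>o\<^sub>p (1/2) *\<^sub>R (F 1 + F 0)"
proof -
  have int: "F integrable_on {0..1}"
    by (rule integrable_continuous_interval[OF cont])
  have F: "(F has_integral integral {0..1} F) {0..1}"
    using int by (rule integrable_integral)
  have refl: "((\<lambda>t. F (1 - t)) has_integral integral {0..1} F) {0..1}"
    using has_integral_affinity[of F "integral {0..1} F" 0 1 "- 1" 1] F
    by (simp add: image_affinity_atLeastAtMost_diff)
  have G: "((\<lambda>t. ((1/2) *\<^sub>R F t + (1/2) *\<^sub>R F (1 - t)) - F (1/2)) has_integral
      ((1/2) *\<^sub>R integral {0..1} F + (1/2) *\<^sub>R integral {0..1} F) - F (1/2)) {0..1}"
    using has_integral_const_real[of "F (1/2)" 0 1]
    by (intro has_integral_diff has_integral_add has_integral_cmul F refl) simp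
  have "positive_op (integral {0..1} (\<lambda>t. ((1/2) *\<^sub>R F t + (1/2) *\<^sub>R F (1 - t)) - F (1/2)))"
  proof (rule positive_op_integral)
    show "positive_op (((1/2) *\<^sub>R F t + (1/2) *\<^sub>R F (1 - t)) - F (1/2))" if "t \<in> {0..1}" for t
    proof -
      have eq: "1/2 * t + (1 - 1/2) * (1 - t) = 1/2"
        by (simp add: field_simps)
      show ?thesis
        using conv[of "1/2" t "1 - t"] that unfolding eq by (simp add: le_op_def)
    qed
  qed (use G in \<open>auto simp: integrable_on_def\<close>)
  then show "F (1/2) \<le>\<^sub>o\<^sub>p integral {0..1} F"
    unfolding integral_unique[OF G] by (simp add: le_op_def flip: scaleR_add_left)
  have id: "((\<lambda>t. t :: real) has_integral 1 / 2) {0..1}"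
    using ident_has_integral[of 0 1] by simp
  have id': "((\<lambda>t. 1 - t :: real) has_integral 1 / 2) {0..1}"
    using has_integral_diff[OF has_integral_const_real[of 1 0 1] id] by simp
  have G: "((\<lambda>t. (t *\<^sub>R F 1 + (1 - t) *\<^sub>R F 0) - F t) has_integral
      ((1/2) *\<^sub>R F 1 + (1/2) *\<^sub>R F 0) - integral {0..1} F) {0..1}"
    by (intro has_integral_diff has_integral_add has_integral_scaleR_left id id' F)
  have "positive_op (integral {0..1} (\<lambda>t. (t *\<^sub>R F 1 + (1 - t) *\<^sub>R F 0) - F t))"
  proof (rule positive_op_integral)
    show "positive_op ((t *\<^sub>R F 1 + (1 - t) *\<^sub>R F 0) - F t)" if "t \<in> {0..1}" for t
      using conv[of t 1 0] that by (simp add: le_op_def)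
  qed (use G in \<open>auto simp: integrable_on_def\<close>)
  then show "integral {0..1} F \<le>\<^sub>o\<^sub>p (1/2) *\<^sub>R (F 1 + F 0)"
    unfolding integral_unique[OF G] by (simp add: le_op_def scaleR_add_right)
qed

text \<open>The compact set on which \<open>f\<close> will be approximated, spanned by the minimum
  and the maximum of the two spectra; \<open>I\<close> itself may be open or unbounded.\<close>

lemma interval_containing_spectra:
  assumes "is_interval I" "compact S" "compact T" "S \<noteq> {}" "T \<noteq> {}" "S \<subseteq> I" "T \<subseteq> (I :: real set)"
  obtains a b where "a \<in> I" "{a..b} \<subseteq> I" "S \<subseteq> {a..b}" "T \<subseteq> {a..b}"
proof -
  have c: "compact (S \<union> T)" "S \<union> T \<noteq> {}"
    using assms by auto
  obtain a where a: "a \<in> S \<union> T" "\<And>x. x \<in> S \<union> T \<Longrightarrow> a \<le> x"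
    using compact_attains_inf[OF c] by blast
  obtain b where b: "b \<in> S \<union> T" "\<And>x. x \<in> S \<union> T \<Longrightarrow> x \<le> b"
    using compact_attains_sup[OF c] by blast
  have I: "a \<in> I" "b \<in> I"
    using a(1) b(1) assms by auto
  show thesis
  proof (rule that)
    show "{a..b} \<subseteq> I"
      using assms(1) I unfolding is_interval_1 by fastforce
  qed (use a(2) b(2) I in auto)
qed

theorem theorem2p5:
  fixes \<A> :: "('h::complex_hilbert \<Rightarrow>\<^sub>L 'h) set"
    and I :: "real set" and f :: "real \<Rightarrow> real"
    and A B :: "'h \<Rightarrow>\<^sub>L 'h"
  assumes "commutative_cstar_algebra \<A>"
    and "is_interval I" and "I \<subseteq> {0<..}"
    and "operator_geometrically_convex \<A> I f"
    and "A \<in> strictly_positive \<A>" and "B \<in> strictly_positive \<A>"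
    and "Sp A \<subseteq> complex_of_real ` I" and "Sp B \<subseteq> complex_of_real ` I"
  shows "fun_op ln (fun_op f (fun_op sqrt (A o\<^sub>L B)))
           \<le>\<^sub>o\<^sub>p integral {0..1} (\<lambda>t. fun_op ln (fun_op f (A powr\<^sub>o\<^sub>p t o\<^sub>L B powr\<^sub>o\<^sub>p (1 - t))))
       \<and> integral {0..1} (\<lambda>t. fun_op ln (fun_op f (A powr\<^sub>o\<^sub>p t o\<^sub>L B powr\<^sub>o\<^sub>p (1 - t))))
           \<le>\<^sub>o\<^sub>p fun_op ln (fun_op sqrt (fun_op f A o\<^sub>L fun_op f B))"
proof (cases "Sp A = {} \<or> Sp B = {}")
  case True
  \<comment> \<open>On the zero space all operators coincide, so both inequalities hold
    trivially.\<close>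
  then have "S = T" for S T :: "'h \<Rightarrow>\<^sub>L 'h"
    using Sp_empty_imp real_spectrum_strictly_positive(1) assms(5,6) by metis
  then have "S \<le>\<^sub>o\<^sub>p T" for S T :: "'h \<Rightarrow>\<^sub>L 'h"
    unfolding le_op_def by (metis positive_op_intros(1))
  then show ?thesis by blast
next
  case False
  note A = real_spectrum_strictly_positive[OF assms(5)]
    and B = real_spectrum_strictly_positive[OF assms(6)]
  have ne: "real_spectrum A \<noteq> {}" "real_spectrum B \<noteq> {}"
    using False Sp_eq_real_spectrum A(1) B(1) by blast+
  have sub: "real_spectrum A \<subseteq> I" "real_spectrum B \<subseteq> I"
    using assms(7,8) by (auto simp: real_spectrum_def)
  obtain a b where ab: "a \<in> I" "{a..b} \<subseteq> I" "real_spectrum A \<subseteq> {a..b}" "real_spectrum B \<subseteq> {a..b}"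
    using interval_containing_spectra[OF assms(2) compact_real_spectrum[OF A(1)]
        compact_real_spectrum[OF B(1)] ne sub] by metis
  have "a > 0" using ab(1) assms(3) by auto
  then have "b > 0" using ab(3) ne(1) by fastforce
  have f: "continuous_on I f" and fpos: "\<And>x. x \<in> I \<Longrightarrow> 0 < f x"
    and geo: "\<And>l X Y. l \<in> {0..1} \<Longrightarrow> X \<in> strictly_positive \<A> \<Longrightarrow> Y \<in> strictly_positive \<A> \<Longrightarrow>
        Sp X \<subseteq> complex_of_real ` I \<Longrightarrow> Sp Y \<subseteq> complex_of_real ` I \<Longrightarrow>
        fun_op f (X powr\<^sub>o\<^sub>p l o\<^sub>L Y powr\<^sub>o\<^sub>p (1 - l))
          \<le>\<^sub>o\<^sub>p fun_op f X powr\<^sub>o\<^sub>p l o\<^sub>L fun_op f Y powr\<^sub>o\<^sub>p (1 - l)"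
    using assms(4) unfolding operator_geometrically_convex_def by auto
  have algebra: "\<And>S T. S \<in> \<A> \<Longrightarrow> T \<in> \<A> \<Longrightarrow> S + T \<in> \<A>"
    "\<And>r T. T \<in> \<A> \<Longrightarrow> r *\<^sub>R T \<in> \<A>"
    "\<And>S T. S \<in> \<A> \<Longrightarrow> T \<in> \<A> \<Longrightarrow> S o\<^sub>L T = T o\<^sub>L S"
    using assms(1) unfolding commutative_cstar_algebra_def
    by (auto simp flip: scaleC_op_of_real)
  \<comment> \<open>Functions of elements of the algebra stay in it, so any two operators formed
    below commute.\<close>
  note in_algebra = fun_op_in_algebra[OF assms(1) id_in_algebra[OF assms(1,5)]]
  have exp_I: "exp x \<in> I" if "x \<in> {ln a..ln b}" for x
  proof -
    have "exp (ln a) \<le> exp x" "exp x \<le> exp (ln b)"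
      using that by simp_all
    then have "a \<le> exp x" "exp x \<le> b"
      using \<open>a > 0\<close> \<open>b > 0\<close> by simp_all
    then show ?thesis using ab(2) by auto
  qed

  have ln: "continuous_on (real_spectrum X) ln" "real_spectrum (fun_op ln X) \<subseteq> {ln a..ln b}"
    if "selfadjoint X" "real_spectrum X \<subseteq> {a..b}" for X :: "'h \<Rightarrow>\<^sub>L 'h"
  proof -
    show c: "continuous_on (real_spectrum X) ln"
      using that(2) \<open>a > 0\<close> by (intro continuous_intros) auto
    show "real_spectrum (fun_op ln X) \<subseteq> {ln a..ln b}"
      using real_spectrum_fun_op[OF that(1) c] that(2) \<open>a > 0\<close> by (fastforce simp: subset_iff)
  qed
  define K where "K = fun_op ln A"
  define L where "L = fun_op ln B"
  have K: "selfadjoint K" "K \<in> \<A>" "real_spectrum K \<subseteq> {ln a..ln b}" "fun_op exp K = A"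
    unfolding K_def using ln[OF A(1) ab(3)] A assms(5)
    by (auto intro!: in_algebra exp_ln_op simp: strictly_positive_def)
  have L: "selfadjoint L" "L \<in> \<A>" "real_spectrum L \<subseteq> {ln a..ln b}" "fun_op exp L = B"
    unfolding L_def using ln[OF B(1) ab(4)] B assms(6)
    by (auto intro!: in_algebra exp_ln_op simp: strictly_positive_def)

  \<comment> \<open>The logarithm of A^t B^(1 - t), with M 1 = K and M 0 = L.\<close>
  define M where "M t = t *\<^sub>R K + (1 - t) *\<^sub>R L" for t
  have M: "selfadjoint (M t)" "M t \<in> \<A>" for t
    using K(1,2) L(1,2) algebra by (auto simp: M_def)
  have M_spec: "real_spectrum (M t) \<subseteq> {ln a..ln b}" if t: "t \<in> {0..1}" for t
  proof -
    \<comment> \<open>The bounds ln a and ln b for the spectra of \<open>K\<close> and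
      \<open>L\<close> become operator inequalities, which convex combinations preserve.\<close>
    have "positive_op (t *\<^sub>R (K - ln a *\<^sub>R id_blinfun) + (1 - t) *\<^sub>R (L - ln a *\<^sub>R id_blinfun))"
      "positive_op (t *\<^sub>R (ln b *\<^sub>R id_blinfun - K) + (1 - t) *\<^sub>R (ln b *\<^sub>R id_blinfun - L))"
      using t K(1) L(1) subsetD[OF K(3)] subsetD[OF L(3)]
      by (auto intro!: positive_op_intros simp flip: real_spectrum_ge_iff real_spectrum_le_iff)
    moreover have "t *\<^sub>R (K - ln a *\<^sub>R id_blinfun) + (1 - t) *\<^sub>R (L - ln a *\<^sub>R id_blinfun)
        = M t - ln a *\<^sub>R id_blinfun"
      "t *\<^sub>R (ln b *\<^sub>R id_blinfun - K) + (1 - t) *\<^sub>R (ln b *\<^sub>R id_blinfun - L)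
        = ln b *\<^sub>R id_blinfun - M t"
      by (simp_all add: M_def algebra_simps)
    ultimately have "real_spectrum (M t) \<subseteq> {ln a..}" "real_spectrum (M t) \<subseteq> {..ln b}"
      unfolding real_spectrum_ge_iff[OF M(1)] real_spectrum_le_iff[OF M(1)] by simp_all
    then show ?thesis by auto
  qed

  \<comment> \<open>The function \<open>f\<close> in logarithmic coordinates: f (exp x) = exp (h x)
    for x between ln a and ln b.\<close>
  define h where "h x = ln (f (exp x))" for x
  have fexp: "continuous_on {ln a..ln b} (\<lambda>x. f (exp x))"
    using exp_I by (intro continuous_on_compose2[OF f] continuous_intros) auto
  have h: "continuous_on {ln a..ln b} h"
    unfolding h_def using fpos exp_I by (intro continuous_on_ln fexp) (auto simp: less_imp_neq[symmetric])
  define F where "F t = fun_op h (M t)" for t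
  have F: "selfadjoint (F t)" "F t \<in> \<A>" "fun_op f (fun_op exp (M t)) = fun_op exp (F t)"
    if t: "t \<in> {0..1}" for t
  proof -
    note hM = continuous_on_subset[OF h M_spec[OF t]]
    show "selfadjoint (F t)" "F t \<in> \<A>"
      unfolding F_def using M hM by (auto intro!: in_algebra)
    have "exp ` real_spectrum (M t) \<subseteq> I"
      using M_spec[OF t] exp_I by auto
    then have "fun_op f (fun_op exp (M t)) = fun_op (\<lambda>x. f (exp x)) (M t)"
      by (intro fun_op_fun_op_exp M continuous_on_subset[OF f])
    also have "\<dots> = fun_op (\<lambda>x. exp (h x)) (M t)"
      using M_spec[OF t] exp_I fpos
      by (intro fun_op_cong M continuous_on_subset[OF fexp]) (auto simp: h_def)
    also have "\<dots> = fun_op exp (F t)"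
      unfolding F_def by (intro fun_op_compose[symmetric] M hM continuous_intros)
    finally show "fun_op f (fun_op exp (M t)) = fun_op exp (F t)" .
  qed

  have exp_prod: "fun_op exp S o\<^sub>L fun_op exp T = fun_op exp (S + T)"
    if "selfadjoint S" "selfadjoint T" "S \<in> \<A>" "T \<in> \<A>" for S T
    using that algebra(3) by (intro exp_add_op[symmetric]) auto
  have exp_geo: "fun_op exp S powr\<^sub>o\<^sub>p r o\<^sub>L fun_op exp T powr\<^sub>o\<^sub>p s = fun_op exp (r *\<^sub>R S + s *\<^sub>R T)"
    if "selfadjoint S" "selfadjoint T" "S \<in> \<A>" "T \<in> \<A>" for S T r s
    using that algebra(2) by (simp add: powr_exp_op exp_prod)

  have "continuous_on {0..1} F"
    unfolding F_def using M_spec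
    by (intro continuous_on_fun_op[where K = "{ln a..ln b}"] M h) (auto simp: M_def intro!: continuous_intros)
  moreover have "F (l * s + (1 - l) * t) \<le>\<^sub>o\<^sub>p l *\<^sub>R F s + (1 - l) *\<^sub>R F t"
    if l: "l \<in> {0..1}" and s: "s \<in> {0..1}" and t: "t \<in> {0..1}" for l s t
  proof -
    have G: "fun_op exp (M u) \<in> strictly_positive \<A>" "Sp (fun_op exp (M u)) \<subseteq> complex_of_real ` I"
      if u: "u \<in> {0..1}" for u
    proof -
      have c: "continuous_on (real_spectrum (M u)) exp"
        by (intro continuous_intros)
      show "fun_op exp (M u) \<in> strictly_positive \<A>"
        by (intro exp_op_strictly_positive M in_algebra c)
      have "real_spectrum (fun_op exp (M u)) \<subseteq> I"
        using real_spectrum_fun_op[OF M(1) c] M_spec[OF u] exp_I by blast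
      then show "Sp (fun_op exp (M u)) \<subseteq> complex_of_real ` I"
        using Sp_eq_real_spectrum[of "fun_op exp (M u)"] M by auto
    qed
    define u where "u = l * s + (1 - l) * t"
    have u: "u \<in> {0..1}"
      using convex_bound_le[of s 1 t l "1 - l"] l s t by (auto simp: u_def)
    \<comment> \<open>\<open>M\<close> is affine, so the weighted geometric mean of exp (M s) and
      exp (M t) is exp (M u), again a point of the curve.\<close>
    have M_comb: "l *\<^sub>R M s + (1 - l) *\<^sub>R M t = M u"
      by (simp add: M_def u_def algebra_simps)
    have comb: "selfadjoint (l *\<^sub>R F s + (1 - l) *\<^sub>R F t)" "l *\<^sub>R F s + (1 - l) *\<^sub>R F t \<in> \<A>"
      using F(1,2)[OF s] F(1,2)[OF t] algebra by auto
    \<comment> \<open>Both sides of geometric convexity are now single exponentials: the product of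
      powers on the right is the exponential of the convex combination of \<open>F s\<close> and
      \<open>F t\<close>. This is the form in which logarithms can be compared.\<close>
    have "fun_op exp (F u) \<le>\<^sub>o\<^sub>p fun_op exp (l *\<^sub>R F s + (1 - l) *\<^sub>R F t)"
      using geo[OF l G(1)[OF s] G(1)[OF t] G(2)[OF s] G(2)[OF t]] F[OF s] F[OF t] F(3)[OF u] M
      by (simp add: exp_geo M_comb)
    then show ?thesis
      unfolding u_def[symmetric]
      by (rule exp_le_op_imp_le_op[OF F(1)[OF u] comb(1) algebra(3)[OF F(2)[OF u] comb(2)]])
  qed
  ultimately have "F (1/2) \<le>\<^sub>o\<^sub>p integral {0..1} F" "integral {0..1} F \<le>\<^sub>o\<^sub>p (1/2) *\<^sub>R (F 1 + F 0)"
    using hermite_hadamard_op[of F] by blast+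
  \<comment> \<open>The identification is made on the interval of integration, where the spectrum of
    exp (M t) stays inside \<open>I\<close>.\<close>
  moreover have "fun_op ln (fun_op f (A powr\<^sub>o\<^sub>p t o\<^sub>L B powr\<^sub>o\<^sub>p (1 - t))) = F t" if "t \<in> {0..1}" for t
    using exp_geo[OF K(1) L(1) K(2) L(2)] F[OF that] by (simp add: K(4) L(4) ln_exp_op flip: M_def)
  then have "integral {0..1} (\<lambda>t. fun_op ln (fun_op f (A powr\<^sub>o\<^sub>p t o\<^sub>L B powr\<^sub>o\<^sub>p (1 - t)))) = integral {0..1} F"
    by (rule integral_cong)
  moreover have "fun_op ln (fun_op f (fun_op sqrt (A o\<^sub>L B))) = F (1/2)"
  proof -
    \<comment> \<open>The root of A B is the midpoint of the curve, where half of the sum of the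
      logarithms sits.\<close>
    have "(1/2) *\<^sub>R (K + L) = M (1/2)"
      by (simp add: M_def scaleR_add_right)
    then have "fun_op sqrt (A o\<^sub>L B) = fun_op exp (M (1/2))"
      using exp_prod[OF K(1) L(1) K(2) L(2)] sqrt_exp_op[of "K + L"] K L by simp
    then show ?thesis
      using F[of "1/2"] by (simp add: ln_exp_op)
  qed
  moreover have "fun_op ln (fun_op sqrt (fun_op f A o\<^sub>L fun_op f B)) = (1/2) *\<^sub>R (F 1 + F 0)"
  proof -
    have "fun_op f A = fun_op exp (F 1)" "fun_op f B = fun_op exp (F 0)"
      using F(3)[of 1] F(3)[of 0] K(4) L(4) by (simp_all add: M_def)
    then show ?thesis
      using F[of 1] F[of 0] exp_prod[of "F 1" "F 0"] by (simp add: sqrt_exp_op ln_exp_op)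
  qed
  ultimately show ?thesis by simp
qed

end
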